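(* Let $\Phi$ be a collection of pairwise disjoint subsets of $\mathcal M\times\Pi$ with $\Psi=\bigcup_{\phi\in\Phi}\phi$, and let $\eta>0$. There is a learning algorithm such that, for every $\Phi$-restricted environment, $$\mathbb{E}\big[\mathrm{Reg}(\pi^\star_{1:T})\big]\le \frac{\log|\Phi|}{\eta}+T\max_{\rho\in\Delta(\Phi)}\max_{\nu\in\Delta(\Psi)}\min_{p\in\Delta(\Pi)}\mathsf{AIR}^\Phi_{\rho,\eta}(p,\nu),$$ where $\pi^\star_{1:T}$ is the comparator sequence chosen by the environment.
   Context: Setting: $\mathcal M$ is a finite class of models, $\Pi$ a finite class of policies, $\mathcal O$ a (discrete) observation space. Each model $M$ specifies, for every $\pi\in\Pi$, a distribution $M(\cdot|\pi)\in\Delta(\mathcal O)$, and a value function $V_M:\Pi\to[0,1]$. In rounds $t=1,\dots,T$ the environment chooses a model $M_t$ (not revealed), the learner chooses $\pi_t\in\Pi$ (possibly at random) and observes $o_t\sim M_t(\cdot|\pi_t)$. The regret against a comparator sequence $\pi^\star_{1:T}$ is $\mathrm{Reg}(\pi^\star_{1:T})=\sum_{t=1}^T\big(V_{M_t}(\pi^\star_t)-V_{M_t}(\pi_t)\big)$. $\Phi$-restricted environment: $\Phi$ is a collection of pairwise disjoint subsets of $\mathcal M\times\Pi$ and $\Psi=\bigcup_{\phi\in\Phi}\phi$. The environment commits to some $\phi^\star\in\Phi$ at the beginning and in each round $t$ selects $(M_t,\pi^\star_t)\in\phi^\star$ arbitrarily based on the history. For $\nu\in\Delta(\Psi)$ write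 $\nu(\phi)=\sum_{(M,\pi^\star)\in\phi}\nu(M,\pi^\star)$ and define the posterior over $\Phi$ given $(\pi,o)$ by $$\nu(\phi|\pi,o)=\frac{\sum_{(M,\pi^\star)\in\phi}\nu(M,\pi^\star)M(o|\pi)}{\sum_{\phi'\in\Phi}\sum_{(M,\pi^\star)\in\phi'}\nu(M,\pi^\star)M(o|\pi)},$$ and write $\nu_{\phi}(\cdot|\pi,o)\in\Delta(\Phi)$ for this distribution. For $\rho\in\Delta(\Phi)$, $\eta>0$, $p\in\Delta(\Pi)$, $\nu\in\Delta(\Psi)$: $$\mathsf{AIR}^\Phi_{\rho,\eta}(p,\nu)=\mathbb E_{\pi\sim p}\mathbb E_{(M,\pi^\star)\sim\nu}\mathbb E_{o\sim M(\cdot|\pi)}\Big[V_M(\pi^\star)-V_M(\pi)-\tfrac1\eta\mathrm{KL}\big(\nu_\phi(\cdot|\pi,o),\rho\big)\Big].$$ *)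

theory Defs
  imports "HOL-Probability.Probability"
begin

text \<open>Models have type 'm, policies 'p, observations 'o (discrete: observation
  distributions are pmfs).  Mdl M pi is the distribution M(.|pi), V M pi = V_M(pi).
  A learning algorithm maps the history (list of (policy, observation) pairs) to a
  distribution over policies.  A Phi-restricted environment is a committed
  phi* in Phi together with a (history-dependent) choice of (M_t, pi*_t) in phi*.\<close>

definition posterior ::
  "('m \<times> 'p) set set \<Rightarrow> ('m \<Rightarrow> 'p \<Rightarrow> 'o pmf) \<Rightarrow> ('m \<times> 'p) pmf \<Rightarrow> 'p \<Rightarrow> 'o
     \<Rightarrow> ('m \<times> 'p) set \<Rightarrow> real" where
  "posterior Phi Mdl \<nu> act ob phi =
     (\<Sum>y\<in>phi. pmf \<nu> y * pmf (Mdl (fst y) act) ob) /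
     (\<Sum>phi'\<in>Phi. \<Sum>y\<in>phi'. pmf \<nu> y * pmf (Mdl (fst y) act) ob)"

definition KL_Phi :: "('m \<times> 'p) set set \<Rightarrow> (('m \<times> 'p) set \<Rightarrow> real) \<Rightarrow> ('m \<times> 'p) set pmf \<Rightarrow> ereal" where
  "KL_Phi Phi q \<rho> =
     (\<Sum>phi\<in>Phi. if q phi = 0 then 0
                 else if pmf \<rho> phi = 0 then \<infinity>
                 else ereal (q phi * ln (q phi / pmf \<rho> phi)))"

definition air_joint ::
  "('m \<Rightarrow> 'p \<Rightarrow> 'o pmf) \<Rightarrow> 'p pmf \<Rightarrow> ('m \<times> 'p) pmf \<Rightarrow> ('p \<times> ('m \<times> 'p) \<times> 'o) pmf" where
  "air_joint Mdl p \<nu> =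
     bind_pmf p (\<lambda>act. bind_pmf \<nu> (\<lambda>x. map_pmf (\<lambda>ob. (act, x, ob)) (Mdl (fst x) act)))"

text \<open>AIR^Phi_{rho,eta}(p,nu) = E[V_M(pi*) - V_M(pi) - KL(nu_phi(.|pi,o), rho)/eta],
  the expectation of the bounded gain term minus 1/eta times the (extended,
  nonnegative) expectation of the KL term.\<close>
definition AIR ::
  "('m \<times> 'p) set set \<Rightarrow> ('m \<Rightarrow> 'p \<Rightarrow> real) \<Rightarrow> ('m \<Rightarrow> 'p \<Rightarrow> 'o pmf)
     \<Rightarrow> ('m \<times> 'p) set pmf \<Rightarrow> real \<Rightarrow> 'p pmf \<Rightarrow> ('m \<times> 'p) pmf \<Rightarrow> ereal" where
  "AIR Phi V Mdl \<rho> \<eta> p \<nu> =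
     ereal (measure_pmf.expectation (air_joint Mdl p \<nu>)
              (\<lambda>(act, x, ob). V (fst x) (snd x) - V (fst x) act))
     - ereal (1 / \<eta>) *
       enn2ereal (\<integral>\<^sup>+ \<omega>. e2ennreal (KL_Phi Phi (posterior Phi Mdl \<nu> (fst \<omega>) (snd (snd \<omega>))) \<rho>)
                 \<partial>measure_pmf (air_joint Mdl p \<nu>))"

fun exp_regret ::
  "('m \<Rightarrow> 'p \<Rightarrow> real) \<Rightarrow> ('m \<Rightarrow> 'p \<Rightarrow> 'o pmf) \<Rightarrow> (('p \<times> 'o) list \<Rightarrow> 'p pmf)
     \<Rightarrow> (('p \<times> 'o) list \<Rightarrow> 'm \<times> 'p) \<Rightarrow> nat \<Rightarrow> ('p \<times> 'o) list \<Rightarrow> real" where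
  "exp_regret V Mdl alg env 0 h = 0"
| "exp_regret V Mdl alg env (Suc n) h =
     measure_pmf.expectation (alg h)
       (\<lambda>act. V (fst (env h)) (snd (env h)) - V (fst (env h)) act
             + measure_pmf.expectation (Mdl (fst (env h)) act)
                 (\<lambda>ob. exp_regret V Mdl alg env n (h @ [(act, ob)])))"

end

theory Submission
  imports Defs "HOL-Complex_Analysis.Great_Picard"
begin

text \<open>Let W be the value of the max-max-min.  For fixed \<rho>, replace the posterior in AIR by an arbitrary
  conditional distribution q over Phi: the resulting surrogate is affine in \<nu>, and minimising it
  over q recovers AIR.  Its values at the point masses x, as (p, q) varies, form a convexlike family,
  so a separating-hyperplane argument yields, for each \<epsilon> > 0, a pair (p, q) with surrogate below
  W + \<epsilon> at every x (otherwise the separating weights \<nu> would have min-AIR above W).  Along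
  a subsequence p, q and the log losses converge, and Fatou's lemma gives a pair attaining W exactly.
  The learner plays p and replaces \<rho> by q(.|\<pi>, o); starting from the uniform
  \<rho>, the log-ratio terms on the class phi* telescope to at most log |Phi| / \<eta>.\<close>

text \<open>The posterior in AIR belongs to some \<nu>, but no \<nu> is revealed to the learner: in
  a round the environment simply picks a pair x, as a function of the history. What controls the
  regret is therefore the surrogate at the single point x. There it equals the expected gain minus
  the expected increase of the logarithm of the mass on phi*, divided by \<eta>, so a bound uniform
  in x is exactly what telescopes. Only \<nu> supported on the classes charged by \<rho> are used,
  which keeps KL finite. This is enough because the update never removes phi* from the support. A
  tolerance \<epsilon> per round is not acceptable in the end, since one algorithm has to meet the
  bound with no slack. Attainment is the difficulty: observations may form an infinite set and log
  losses have no upper bound, so the surrogate is not continuous on a compact set. Losses are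
  nonnegative, however, and in the limit they can only drop. That direction is all an upper bound
  needs.\<close>

section \<open>A theorem of the alternative for convexlike families\<close>

lemma two_function_alternative:
  fixes f g :: "'c \<Rightarrow> real"
  assumes C: "C \<noteq> {}"
    and mix: "\<And>c d t. \<lbrakk>c \<in> C; d \<in> C; 0 \<le> t; t \<le> 1\<rbrakk> \<Longrightarrow>
      \<exists>e\<in>C. f e \<le> t * f c + (1 - t) * f d \<and> g e \<le> t * g c + (1 - t) * g d"
    and none: "\<not> (\<exists>c\<in>C. f c < 0 \<and> g c < 0)"
  obtains a b where "0 \<le> a" "0 \<le> b" "a + b = 1" "\<And>c. c \<in> C \<Longrightarrow> 0 \<le> a * f c + b * g c"
proof -
  \<comment> \<open>The image of \<open>C\<close> in the plane need not be convex, but its upward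
    closure is, by \<open>mix\<close>. Upward closure also forces the separating normal to have
    nonnegative coordinates.\<close>
  define K where "K = {z :: real \<times> real. \<exists>c\<in>C. f c \<le> fst z \<and> g c \<le> snd z}"
  define N where "N = {..<0::real} \<times> {..<0::real}"
  have "convex K"
    unfolding convex_alt
  proof (intro ballI allI impI)
    fix y z :: "real \<times> real" and u :: real
    assume "y \<in> K" "z \<in> K" and u: "0 \<le> u \<and> u \<le> 1"
    then obtain c d where cd: "c \<in> C" "d \<in> C" "f c \<le> fst y" "g c \<le> snd y" "f d \<le> fst z" "g d \<le> snd z"
      unfolding K_def by blast
    obtain e where e: "e \<in> C" "f e \<le> (1 - u) * f c + u * f d" "g e \<le> (1 - u) * g c + u * g d"
      using mix[of c d "1 - u"] cd u by auto
    have "f e \<le> (1 - u) * fst y + u * fst z" "g e \<le> (1 - u) * snd y + u * snd z"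
      using e cd u by (auto intro!: order_trans[OF e(2)] order_trans[OF e(3)] add_mono mult_left_mono)
    then show "(1 - u) *\<^sub>R y + u *\<^sub>R z \<in> K"
      unfolding K_def using e(1) by auto
  qed
  moreover have "convex N" unfolding N_def by (intro convex_Times) auto
  moreover have "K \<noteq> {}" using C unfolding K_def by fastforce
  moreover have "N \<noteq> {}" unfolding N_def by (auto intro!: exI[of _ "-1"])
  moreover have "K \<inter> N = {}" using none unfolding K_def N_def by fastforce
  ultimately obtain w :: "real \<times> real" and s where w: "w \<noteq> 0" and wN: "\<forall>z\<in>N. inner w z \<le> s" and wK: "\<forall>z\<in>K. s \<le> inner w z"
    using separating_hyperplane_sets[of N K] by (metis inf_commute)
  obtain a b where ab: "w = (a, b)" by force
  \<comment> \<open>Points of \<open>N\<close> come arbitrarily close to the origin, so the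
    separating level cannot be negative; \<open>r\<close> is scaled to make the error at (-r, -r) at
    most \<epsilon>.\<close>
  have s: "0 \<le> s + \<epsilon>" if "\<epsilon> > 0" for \<epsilon>
  proof -
    define r where "r = \<epsilon> / (\<bar>a\<bar> + \<bar>b\<bar> + 1)"
    have r: "r > 0" using that by (simp add: r_def)
    then have "(-r, -r) \<in> N" by (simp add: N_def)
    then have "inner w (-r, -r) \<le> s" using wN by blast
    moreover have "r * (a + b) \<le> r * (\<bar>a\<bar> + \<bar>b\<bar> + 1)" using r by (intro mult_left_mono) auto
    moreover have "r * (\<bar>a\<bar> + \<bar>b\<bar> + 1) = \<epsilon>" by (simp add: r_def)
    ultimately show ?thesis by (simp add: ab algebra_simps)
  qed
  have s0: "0 \<le> s" using s by (rule field_le_epsilon)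
  obtain c0 where c0: "c0 \<in> C" using C by blast
  \<comment> \<open>A function affine in k that stays nonnegative for all k \<ge> 0 has nonnegative
    slope. It is applied along the two upward rays from a point of \<open>K\<close>.\<close>
  have pos: "0 \<le> \<alpha>" if up: "\<And>k. 0 \<le> k \<Longrightarrow> 0 \<le> \<beta> + k * \<alpha>" for \<alpha> \<beta> :: real
  proof (rule ccontr)
    assume "\<not> 0 \<le> \<alpha>"
    then have "\<alpha> < 0" by simp
    then have "\<beta> + ((\<bar>\<beta>\<bar> + 1) / - \<alpha>) * \<alpha> = \<beta> - (\<bar>\<beta>\<bar> + 1)" by (simp add: field_simps)
    then show False using up[of "(\<bar>\<beta>\<bar> + 1) / - \<alpha>"] \<open>\<alpha> < 0\<close> by (simp add: divide_nonneg_neg)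
  qed
  have K1: "0 \<le> a * u + b * v" if "c \<in> C" "f c \<le> u" "g c \<le> v" for c u v
  proof -
    have "(u, v) \<in> K" using that unfolding K_def by auto
    then have "s \<le> inner w (u, v)" using wK by blast
    with s0 show ?thesis by (simp add: ab)
  qed
  have "0 \<le> a"
    by (rule pos[of "a * f c0 + b * g c0"]) (use K1[OF c0, of "f c0 + k" "g c0" for k] in \<open>simp add: algebra_simps\<close>)
  moreover have "0 \<le> b"
    by (rule pos[of "a * f c0 + b * g c0"]) (use K1[OF c0, of "f c0" "g c0 + k" for k] in \<open>simp add: algebra_simps\<close>)
  ultimately have "0 < a + b" using w ab by (auto simp: zero_prod_def)
  show thesis
  proof (rule that[of "a / (a + b)" "b / (a + b)"])
    show "0 \<le> a / (a + b) * f c + b / (a + b) * g c" if "c \<in> C" for c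
    proof -
      have "a / (a + b) * f c + b / (a + b) * g c = (a * f c + b * g c) / (a + b)"
        by (simp add: add_divide_distrib)
      then show ?thesis using K1[OF that order_refl order_refl] \<open>0 < a + b\<close> by simp
    qed
  qed (use \<open>0 \<le> a\<close> \<open>0 \<le> b\<close> \<open>0 < a + b\<close> in \<open>auto simp: add_divide_distrib[symmetric]\<close>)
qed

text \<open>Induction on \<open>X\<close> needs separation in the plane only: the functions already
  treated are merged into one weighted function, which is then paired with the new one.
  \<open>C\<close> is generalised because the induction hypothesis is applied to a subset of it,
  possibly empty.\<close>

lemma finite_family_alternative:
  fixes f :: "'x \<Rightarrow> 'c \<Rightarrow> real"
  assumes "finite X" "X \<noteq> {}"
    and "\<And>c d t. \<lbrakk>c \<in> C; d \<in> C; 0 \<le> t; t \<le> 1\<rbrakk> \<Longrightarrow>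
      \<exists>e\<in>C. \<forall>x\<in>X. f x e \<le> t * f x c + (1 - t) * f x d"
    and "\<not> (\<exists>c\<in>C. \<forall>x\<in>X. f x c < 0)"
  shows "\<exists>w. (\<forall>x\<in>X. 0 \<le> w x) \<and> sum w X = 1 \<and> (\<forall>c\<in>C. 0 \<le> (\<Sum>x\<in>X. w x * f x c))"
  using assms
proof (induction X arbitrary: C rule: finite_ne_induct)
  case (singleton z)
  then show ?case by (intro exI[of _ "\<lambda>_. 1"]) (auto simp: not_less)
next
  case (insert z X)
  \<comment> \<open>Negativity at z survives mixing, so \<open>D\<close> is again convexlike. On
    \<open>D\<close> no point is negative at all of \<open>X\<close>, hence the weights from the
    induction hypothesis make the merged function nonnegative wherever \<open>f z\<close> is
    negative.\<close>
  define D where "D = {c\<in>C. f z c < 0}"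
  have "\<exists>w. (\<forall>x\<in>X. 0 \<le> w x) \<and> sum w X = 1 \<and> (\<forall>c\<in>D. 0 \<le> (\<Sum>x\<in>X. w x * f x c))"
  proof (rule insert.IH)
    fix c d and t :: real assume D: "c \<in> D" "d \<in> D" and t: "0 \<le> t" "t \<le> 1"
    then obtain e where e: "e \<in> C" "\<forall>x\<in>insert z X. f x e \<le> t * f x c + (1 - t) * f x d"
      using insert.prems(1)[of c d t] by (auto simp: D_def)
    have "t * f z c + (1 - t) * f z d < 0"
      using convex_bound_lt[of "f z c" 0 "f z d" t "1 - t"] D t by (simp add: D_def)
    with e show "\<exists>e\<in>D. \<forall>x\<in>X. f x e \<le> t * f x c + (1 - t) * f x d"
      by (intro bexI[of _ e]) (auto simp: D_def)
  next
    show "\<not> (\<exists>c\<in>D. \<forall>x\<in>X. f x c < 0)" using insert.prems(2) by (auto simp: D_def)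
  qed
  then obtain w where w: "\<And>x. x \<in> X \<Longrightarrow> 0 \<le> w x" "sum w X = 1"
    "\<And>c. c \<in> D \<Longrightarrow> 0 \<le> (\<Sum>x\<in>X. w x * f x c)" by blast
  show ?case
  proof (cases "C = {}")
    case True
    then show ?thesis using insert.hyps
      by (intro exI[of _ "\<lambda>x. if x = z then 1 else 0"]) (auto simp: sum.delta')
  next
    case False
    define g where "g c = (\<Sum>x\<in>X. w x * f x c)" for c
    have "\<exists>e\<in>C. g e \<le> t * g c + (1 - t) * g d \<and> f z e \<le> t * f z c + (1 - t) * f z d"
      if cdt: "c \<in> C" "d \<in> C" "0 \<le> t" "t \<le> 1" for c d t
    proof -
      obtain e where e: "e \<in> C" "\<forall>x\<in>insert z X. f x e \<le> t * f x c + (1 - t) * f x d"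
        using insert.prems(1)[OF cdt] by blast
      have "g e \<le> (\<Sum>x\<in>X. w x * (t * f x c + (1 - t) * f x d))"
        unfolding g_def using e w by (intro sum_mono mult_left_mono) auto
      also have "\<dots> = t * g c + (1 - t) * g d"
        by (simp add: g_def sum_distrib_left sum.distrib algebra_simps sum_subtractf)
      finally show ?thesis using e by auto
    qed
    moreover have "\<not> (\<exists>c\<in>C. g c < 0 \<and> f z c < 0)"
      using w(3) by (force simp: D_def g_def)
    ultimately obtain a b where ab: "0 \<le> a" "0 \<le> b" "a + b = 1" "\<And>c. c \<in> C \<Longrightarrow> 0 \<le> a * g c + b * f z c"
      using two_function_alternative[OF False, of g "f z"] by blast
    define w' where "w' x = (if x = z then b else a * w x)" for x
    have eq: "sum (\<lambda>x. w' x * h x) (insert z X) = a * (\<Sum>x\<in>X. w x * h x) + b * h z" for h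
    proof -
      have "(\<Sum>x\<in>X. w' x * h x) = (\<Sum>x\<in>X. a * (w x * h x))"
        using insert.hyps by (intro sum.cong) (auto simp: w'_def)
      then show ?thesis using insert.hyps by (simp add: w'_def sum_distrib_left)
    qed
    have "sum w' (insert z X) = 1" using eq[of "\<lambda>_. 1"] w ab by simp
    moreover have "0 \<le> w' x" if "x \<in> insert z X" for x
      using that ab w by (auto simp: w'_def)
    moreover have "0 \<le> (\<Sum>x\<in>insert z X. w' x * f x c)" if "c \<in> C" for c
      using ab(4)[OF that] by (simp only: eq g_def)
    ultimately show ?thesis by blast
  qed
qed

section \<open>Expectations under pmfs, posterior averages and relative entropy\<close>

lemma integrable_pmf_bounded:
  fixes f :: "'a \<Rightarrow> real"
  assumes "\<And>x. x \<in> set_pmf M \<Longrightarrow> \<bar>f x\<bar> \<le> B"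
  shows "integrable (measure_pmf M) f"
  using assms by (intro measure_pmf.integrable_const_bound[where B=B]) (auto simp: AE_measure_pmf_iff)

lemma ln_interpolate:
  fixes a b s :: real
  assumes "0 < a" "0 < b" "0 \<le> s" "s \<le> 1"
  shows "s * ln a + (1 - s) * ln b \<le> ln (s * a + (1 - s) * b)"
proof -
  have "(1 - s) * ln b + s * ln a \<le> ln ((1 - s) *\<^sub>R b + s *\<^sub>R a)"
    using concave_onD[OF ln_concave, of s b a] assms by auto
  then show ?thesis by (simp add: algebra_simps)
qed

text \<open>Both sides are integrals over the same density; multiplying the ratio by its
  denominator is harmless where the denominator vanishes, as then all terms vanish.\<close>
lemma posterior_tower:
  fixes \<nu> :: "'x \<Rightarrow> real" and K :: "'x \<Rightarrow> 'o pmf" and h :: "'x set \<Rightarrow> 'o \<Rightarrow> real"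
  assumes fin: "finite Q" "\<And>A. A \<in> Q \<Longrightarrow> finite A" and dis: "pairwise disjnt Q"
    and cls: "\<And>A x. A \<in> Q \<Longrightarrow> x \<in> A \<Longrightarrow> cls x = A"
    and \<nu>: "\<And>x. x \<in> \<Union>Q \<Longrightarrow> 0 \<le> \<nu> x"
    and h: "\<And>A ob. A \<in> Q \<Longrightarrow> \<bar>h A ob\<bar> \<le> B"
  defines "S A ob \<equiv> (\<Sum>x\<in>A. \<nu> x * pmf (K x) ob)"
  defines "post A ob \<equiv> S A ob / (\<Sum>A'\<in>Q. S A' ob)"
  shows "(\<Sum>x\<in>\<Union>Q. \<nu> x * measure_pmf.expectation (K x) (\<lambda>ob. \<Sum>A\<in>Q. post A ob * h A ob))
     = (\<Sum>x\<in>\<Union>Q. \<nu> x * measure_pmf.expectation (K x) (h (cls x)))"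
proof -
  have S0: "0 \<le> S A ob" if "A \<in> Q" for A ob
    unfolding S_def using that \<nu> by (intro sum_nonneg mult_nonneg_nonneg) auto
  have split: "(\<Sum>x\<in>\<Union>Q. g x) = (\<Sum>A\<in>Q. \<Sum>x\<in>A. g x)" for g :: "'x \<Rightarrow> real"
    using fin dis by (subst sum.Union_disjoint) (auto simp: pairwise_def disjnt_def)
  have finU: "finite (\<Union>Q)" using fin by blast
  have post01: "0 \<le> post A ob" "post A ob \<le> 1" if "A \<in> Q" for A ob
  proof -
    have "S A ob \<le> (\<Sum>A'\<in>Q. S A' ob)" using that fin S0 by (intro member_le_sum) auto
    moreover have "0 \<le> (\<Sum>A'\<in>Q. S A' ob)" using S0 by (rule sum_nonneg)
    ultimately show "0 \<le> post A ob" "post A ob \<le> 1"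
      unfolding post_def using S0[OF that, of ob]
      by (auto simp: divide_le_eq_1 less_le intro!: divide_nonneg_nonneg)
  qed
  \<comment> \<open>The laws \<open>K x\<close> differ with x. Counting measure is common to all of
    them, so the finite sum over x can be moved under one integral and compared observation by
    observation.\<close>
  have int: "integrable (count_space UNIV) (\<lambda>ob. pmf (K x) ob * g ob)"
    and ev: "measure_pmf.expectation (K x) g = (\<integral>ob. pmf (K x) ob * g ob \<partial>count_space UNIV)"
    if "\<And>ob. \<bar>g ob\<bar> \<le> C" for g C x
  proof -
    have "integrable (measure_pmf (K x)) g" using that by (rule integrable_pmf_bounded)
    then show "integrable (count_space UNIV) (\<lambda>ob. pmf (K x) ob * g ob)"
      unfolding measure_pmf_eq_density by (subst (asm) integrable_density) auto
    show "measure_pmf.expectation (K x) g = (\<integral>ob. pmf (K x) ob * g ob \<partial>count_space UNIV)"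
      unfolding measure_pmf_eq_density by (subst integral_density) auto
  qed
  define H where "H ob = (\<Sum>A\<in>Q. post A ob * h A ob)" for ob
  have H: "\<bar>H ob\<bar> \<le> real (card Q) * B" for ob
  proof -
    have "\<bar>H ob\<bar> \<le> (\<Sum>A\<in>Q. \<bar>post A ob * h A ob\<bar>)" unfolding H_def by (rule sum_abs)
    also have "\<dots> \<le> (\<Sum>A\<in>Q. B)"
    proof (rule sum_mono)
      fix A assume A: "A \<in> Q"
      have "\<bar>post A ob * h A ob\<bar> \<le> 1 * B"
        unfolding abs_mult using post01[OF A] h[OF A] by (intro mult_mono) auto
      then show "\<bar>post A ob * h A ob\<bar> \<le> B" by simp
    qed
    finally show ?thesis by simp
  qed
  have key: "(\<Sum>x\<in>\<Union>Q. \<nu> x * (pmf (K x) ob * H ob)) = (\<Sum>x\<in>\<Union>Q. \<nu> x * (pmf (K x) ob * h (cls x) ob))" for ob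
  proof -
    have "(\<Sum>x\<in>\<Union>Q. \<nu> x * (pmf (K x) ob * H ob)) = (\<Sum>A'\<in>Q. S A' ob) * H ob"
      unfolding split S_def by (simp add: sum_distrib_right mult.assoc)
    also have "\<dots> = (\<Sum>A\<in>Q. S A ob * h A ob)"
    proof (cases "(\<Sum>A'\<in>Q. S A' ob) = 0")
      case True
      then have "\<forall>A\<in>Q. S A ob = 0" using fin S0 by (subst (asm) sum_nonneg_eq_0_iff) auto
      then show ?thesis using True by simp
    next
      case False
      then show ?thesis by (simp add: H_def post_def sum_distrib_left)
    qed
    also have "\<dots> = (\<Sum>x\<in>\<Union>Q. \<nu> x * (pmf (K x) ob * h (cls x) ob))"
      unfolding split S_def by (auto simp: sum_distrib_right cls mult.assoc intro!: sum.cong)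
    finally show ?thesis .
  qed
  have hc: "\<bar>h (cls x) ob\<bar> \<le> B" if "x \<in> \<Union>Q" for x ob using that cls h by auto
  have "(\<Sum>x\<in>\<Union>Q. \<nu> x * measure_pmf.expectation (K x) H)
     = (\<integral>ob. (\<Sum>x\<in>\<Union>Q. \<nu> x * (pmf (K x) ob * H ob)) \<partial>count_space UNIV)"
    by (subst Bochner_Integration.integral_sum) (auto simp: ev[OF H] intro!: integrable_mult_right int[OF H])
  also have "\<dots> = (\<integral>ob. (\<Sum>x\<in>\<Union>Q. \<nu> x * (pmf (K x) ob * h (cls x) ob)) \<partial>count_space UNIV)"
    by (simp only: key)
  also have "\<dots> = (\<Sum>x\<in>\<Union>Q. \<nu> x * measure_pmf.expectation (K x) (h (cls x)))"
  proof (subst Bochner_Integration.integral_sum)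
    fix x assume "x \<in> \<Union>Q"
    then show "integrable (count_space UNIV) (\<lambda>ob. \<nu> x * (pmf (K x) ob * h (cls x) ob))"
      by (intro integrable_mult_right int[OF hc])
  next
    show "(\<Sum>x\<in>\<Union>Q. \<integral>ob. \<nu> x * (pmf (K x) ob * h (cls x) ob) \<partial>count_space UNIV) =
      (\<Sum>x\<in>\<Union>Q. \<nu> x * measure_pmf.expectation (K x) (h (cls x)))"
      by (intro sum.cong) (auto simp: ev[OF hc] )
  qed
  finally show ?thesis unfolding H_def .
qed

text \<open>The factor 1 - d absorbs the cost of replacing the optimal q by any q' at least (1 - d) q.\<close>
lemma relative_entropy_bounds:
  fixes q r q' :: "'a \<Rightarrow> real"
  assumes "finite Q" "\<And>A. A \<in> Q \<Longrightarrow> 0 \<le> q A" "sum q Q = 1"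
    and "\<And>A. A \<in> Q \<Longrightarrow> 0 < r A" "sum r Q \<le> 1" and d: "d < 1"
    and "\<And>A. A \<in> Q \<Longrightarrow> (1 - d) * q A \<le> q' A"
  shows "0 \<le> (\<Sum>A\<in>Q. q A * ln (q A / r A))"
    and "(\<Sum>A\<in>Q. q A * ln (q A / r A)) \<le> (\<Sum>A\<in>Q. q A * (ln (q' A) - ln (r A))) - ln (1 - d)"
proof -
  \<comment> \<open>Gibbs' inequality term by term, from the tangent bound ln z \<le> z - 1;
    summation uses that \<open>r\<close> has total mass at most that of \<open>q\<close>.\<close>
  have "q A - r A \<le> q A * ln (q A / r A)" if A: "A \<in> Q" for A
  proof (cases "q A = 0")
    case False
    then have "0 < q A" "0 < r A" using assms that by (auto simp: less_le)
    then have "ln (r A / q A) \<le> r A / q A - 1" by (intro ln_le_minus_one) simp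
    then have "q A * ln (r A / q A) \<le> q A * (r A / q A - 1)"
      using \<open>0 < q A\<close> by (intro mult_left_mono) auto
    then show ?thesis using \<open>0 < q A\<close> \<open>0 < r A\<close> by (simp add: ln_div algebra_simps)
  qed (use assms(4)[OF A] in auto)
  then have "sum q Q - sum r Q \<le> (\<Sum>A\<in>Q. q A * ln (q A / r A))"
    unfolding sum_subtractf[symmetric] by (rule sum_mono)
  then show "0 \<le> (\<Sum>A\<in>Q. q A * ln (q A / r A))" using assms by simp
  have "(\<Sum>A\<in>Q. q A * ln (q A / r A)) \<le> (\<Sum>A\<in>Q. q A * (ln (q' A) - ln (r A)) - q A * ln (1 - d))"
  proof (rule sum_mono)
    fix A assume A: "A \<in> Q"
    show "q A * ln (q A / r A) \<le> q A * (ln (q' A) - ln (r A)) - q A * ln (1 - d)"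
    proof (cases "q A = 0")
      case False
      then have q: "0 < q A" and r: "0 < r A" using assms A by (auto simp: less_le)
      then have "0 < (1 - d) * q A" using d by simp
      then have "ln ((1 - d) * q A) \<le> ln (q' A)" using assms(7)[OF A] by simp
      then have "ln (q A / r A) \<le> ln (q' A) - ln (r A) - ln (1 - d)"
        using q r d by (simp add: ln_mult ln_div)
      then have "q A * ln (q A / r A) \<le> q A * (ln (q' A) - ln (r A) - ln (1 - d))"
        using q by (intro mult_left_mono) auto
      then show ?thesis by (simp add: algebra_simps)
    qed simp
  qed
  also have "\<dots> = (\<Sum>A\<in>Q. q A * (ln (q' A) - ln (r A))) - ln (1 - d)"
    by (simp add: sum_subtractf assms(3) sum_distrib_right[symmetric])
  finally show "(\<Sum>A\<in>Q. q A * ln (q A / r A)) \<le> (\<Sum>A\<in>Q. q A * (ln (q' A) - ln (r A))) - ln (1 - d)" .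
qed

lemma nn_integral_measure_pmf_finite_real:
  assumes "finite A" "set_pmf M \<subseteq> A" "\<And>x. x \<in> set_pmf M \<Longrightarrow> 0 \<le> g x"
  shows "(\<integral>\<^sup>+x. ennreal (g x) \<partial>measure_pmf M) = ennreal (\<Sum>x\<in>A. pmf M x * g x)"
    and "0 \<le> (\<Sum>x\<in>A. pmf M x * g x)"
proof -
  have "finite (set_pmf M)" using assms finite_subset by blast
  then have "(\<integral>\<^sup>+x. ennreal (g x) \<partial>measure_pmf M) = ennreal (measure_pmf.expectation M g)"
    using assms by (intro nn_integral_eq_integral integrable_measure_pmf_finite) (auto simp: AE_measure_pmf_iff)
  also have "measure_pmf.expectation M g = (\<Sum>x\<in>A. pmf M x * g x)"
    using assms by (subst integral_measure_pmf[of A]) auto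
  finally show "(\<integral>\<^sup>+x. ennreal (g x) \<partial>measure_pmf M) = ennreal (\<Sum>x\<in>A. pmf M x * g x)" .
  show "0 \<le> (\<Sum>x\<in>A. pmf M x * g x)"
  proof (rule sum_nonneg)
    fix x show "0 \<le> pmf M x * g x"
      using assms(3)[of x] by (cases "x \<in> set_pmf M") (auto simp: set_pmf_iff)
  qed
qed

lemma nn_integral_air_joint:
  "(\<integral>\<^sup>+\<omega>. f (fst \<omega>) (snd (snd \<omega>)) \<partial>measure_pmf (air_joint Mdl p \<nu>))
     = (\<integral>\<^sup>+a. \<integral>\<^sup>+x. \<integral>\<^sup>+ob. f a ob \<partial>measure_pmf (Mdl (fst x) a) \<partial>measure_pmf \<nu> \<partial>measure_pmf p)"
  by (simp add: air_joint_def)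

lemma expectation_air_joint:
  fixes f :: "'p \<Rightarrow> 'm \<times> 'p \<Rightarrow> real"
  assumes "finite A" "set_pmf p \<subseteq> A" "finite X" "set_pmf \<nu> \<subseteq> X"
  shows "measure_pmf.expectation (air_joint Mdl p \<nu>) (\<lambda>(a, x, ob). f a x)
     = (\<Sum>a\<in>A. pmf p a * (\<Sum>x\<in>X. pmf \<nu> x * f a x))"
proof -
  \<comment> \<open>The gain ignores the observation, and action and x are independent under the
    joint law. The possibly infinite observation support thus drops out and a finite sum
    remains.\<close>
  have pair: "map_pmf (\<lambda>(a, x, ob). (a, x)) (air_joint Mdl p \<nu>) = pair_pmf p \<nu>"
    by (simp add: air_joint_def pair_pmf_def map_bind_pmf pmf.map_comp comp_def map_pmf_const)
  have "measure_pmf.expectation (air_joint Mdl p \<nu>) (\<lambda>(a, x, ob). f a x)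
      = measure_pmf.expectation (map_pmf (\<lambda>(a, x, ob). (a, x)) (air_joint Mdl p \<nu>)) (\<lambda>(a, x). f a x)"
    by (simp add: case_prod_unfold)
  also have "\<dots> = (\<Sum>z\<in>A \<times> X. pmf (pair_pmf p \<nu>) z *\<^sub>R (case z of (a, x) \<Rightarrow> f a x))"
    unfolding pair using assms by (intro integral_measure_pmf) auto
  also have "\<dots> = (\<Sum>a\<in>A. pmf p a * (\<Sum>x\<in>X. pmf \<nu> x * f a x))"
    by (auto simp: sum_distrib_left sum.cartesian_product pmf_pair mult.assoc intro!: sum.cong)
  finally show ?thesis .
qed

section \<open>The surrogate as a lower bound for AIR\<close>

locale restricted_class =
  fixes Ms :: "'m set" and Pol :: "'p set" and Phi :: "('m \<times> 'p) set set"
    and Mdl :: "'m \<Rightarrow> 'p \<Rightarrow> 'o pmf" and V :: "'m \<Rightarrow> 'p \<Rightarrow> real" and \<eta> :: real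
  assumes finite_Ms: "finite Ms" and finite_Pol: "finite Pol" and Pol_nonempty: "Pol \<noteq> {}"
    and V_bounds: "\<And>M act. M \<in> Ms \<Longrightarrow> act \<in> Pol \<Longrightarrow> 0 \<le> V M act \<and> V M act \<le> 1"
    and Phi_subset: "\<And>phi. phi \<in> Phi \<Longrightarrow> phi \<subseteq> Ms \<times> Pol"
    and Phi_disjoint: "pairwise disjnt Phi"
    and eta_pos: "\<eta> > 0"
begin

text \<open>Meaningful only on \<Union>Phi; elsewhere THE is unspecified.\<close>
definition cls :: "'m \<times> 'p \<Rightarrow> ('m \<times> 'p) set" where
  "cls x = (THE phi. phi \<in> Phi \<and> x \<in> phi)"

lemma cls_eq: "phi \<in> Phi \<Longrightarrow> x \<in> phi \<Longrightarrow> cls x = phi"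
  unfolding cls_def using Phi_disjoint by (intro the_equality) (blast, metis pairwiseD disjnt_iff)

lemma finite_Phi: "finite Phi"
  by (rule finite_subset[of _ "Pow (Ms \<times> Pol)"]) (use Phi_subset finite_Ms finite_Pol in auto)

lemma finite_class: "phi \<in> Phi \<Longrightarrow> finite phi"
  using Phi_subset finite_Ms finite_Pol finite_subset by fastforce

lemma finite_Union_support: "set_pmf \<rho> \<subseteq> Phi \<Longrightarrow> finite (\<Union>(set_pmf \<rho>))"
  using finite_Phi finite_class finite_subset by blast

text \<open>AIR with the posterior replaced by an arbitrary conditional distribution q and \<nu> by a
  point mass at x: linear in p, convex in q, and minimal over q (in \<nu>-average) at the posterior.\<close>
definition surrogate ::
  "('m \<times> 'p) set pmf \<Rightarrow> ('p \<Rightarrow> real) \<Rightarrow> ('p \<Rightarrow> 'o \<Rightarrow> ('m \<times> 'p) set \<Rightarrow> real) \<Rightarrow> 'm \<times> 'p \<Rightarrow> real" where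
  "surrogate \<rho> p q x = (\<Sum>a\<in>Pol. p a * (V (fst x) (snd x) - V (fst x) a
     + 1 / \<eta> * measure_pmf.expectation (Mdl (fst x) a) (\<lambda>ob. ln (pmf \<rho> (cls x)) - ln (q a ob (cls x)))))"

text \<open>Lets every sum over \<open>Phi\<close> shrink to the support of \<rho>: by disjointness,
  a class outside it contains no point charged by \<nu>. Normalisation is claimed only at
  observations that can occur, since elsewhere the denominator may be 0 and the posterior is then
  identically 0.\<close>

lemma posterior_support:
  assumes \<rho>: "set_pmf \<rho> \<subseteq> Phi" and \<nu>: "set_pmf \<nu> \<subseteq> \<Union>(set_pmf \<rho>)"
  defines "S phi act ob \<equiv> \<Sum>y\<in>phi. pmf \<nu> y * pmf (Mdl (fst y) act) ob"
  shows "posterior Phi Mdl \<nu> act ob phi = S phi act ob / (\<Sum>A\<in>set_pmf \<rho>. S A act ob)"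
    and "phi \<in> Phi \<Longrightarrow> phi \<notin> set_pmf \<rho> \<Longrightarrow> posterior Phi Mdl \<nu> act ob phi = 0"
    and "phi \<in> Phi \<Longrightarrow> 0 \<le> posterior Phi Mdl \<nu> act ob phi"
    and "x \<in> set_pmf \<nu> \<Longrightarrow> ob \<in> set_pmf (Mdl (fst x) act) \<Longrightarrow> (\<Sum>A\<in>set_pmf \<rho>. posterior Phi Mdl \<nu> act ob A) = 1"
proof -
  have zero: "S A act ob = 0" if "A \<in> Phi" "A \<notin> set_pmf \<rho>" for A
  proof -
    have "y \<notin> set_pmf \<nu>" if y: "y \<in> A" for y
    proof
      assume "y \<in> set_pmf \<nu>"
      then obtain B where "B \<in> set_pmf \<rho>" "y \<in> B" using \<nu> by blast
      then show False using cls_eq[of A y] cls_eq[of B y] that \<open>A \<in> Phi\<close> \<open>A \<notin> set_pmf \<rho>\<close> \<rho> y by auto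
    qed
    then show ?thesis unfolding S_def by (intro sum.neutral) (auto simp: set_pmf_iff)
  qed
  have "(\<Sum>A\<in>Phi. S A act ob) = (\<Sum>A\<in>set_pmf \<rho>. S A act ob)"
    using \<rho> finite_Phi zero by (intro sum.mono_neutral_right) auto
  then show eq: "posterior Phi Mdl \<nu> act ob phi = S phi act ob / (\<Sum>A\<in>set_pmf \<rho>. S A act ob)" for phi
    by (simp add: posterior_def S_def)
  show "phi \<in> Phi \<Longrightarrow> phi \<notin> set_pmf \<rho> \<Longrightarrow> posterior Phi Mdl \<nu> act ob phi = 0"
    by (simp add: eq zero)
  have S0: "0 \<le> S A act ob" for A unfolding S_def by (intro sum_nonneg) simp
  then show "phi \<in> Phi \<Longrightarrow> 0 \<le> posterior Phi Mdl \<nu> act ob phi"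
    unfolding eq by (intro divide_nonneg_nonneg sum_nonneg)
  show "(\<Sum>A\<in>set_pmf \<rho>. posterior Phi Mdl \<nu> act ob A) = 1"
    if x: "x \<in> set_pmf \<nu>" "ob \<in> set_pmf (Mdl (fst x) act)"
  proof -
    obtain B where B: "B \<in> set_pmf \<rho>" "x \<in> B" using x \<nu> by blast
    have "0 < pmf \<nu> x * pmf (Mdl (fst x) act) ob" using x by (simp add: pmf_positive)
    also have "\<dots> \<le> S B act ob" unfolding S_def
      using B finite_class \<rho> by (intro member_le_sum) auto
    also have "\<dots> \<le> (\<Sum>A\<in>set_pmf \<rho>. S A act ob)"
      using B S0 finite_subset[OF \<rho> finite_Phi] by (intro member_le_sum) auto
    finally show ?thesis by (simp add: eq sum_divide_distrib[symmetric])
  qed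
qed

text \<open>The conversion \<open>ennreal\<close> cuts negative numbers to 0. Nonnegativity of the
  bound is therefore recorded too: it lets the nonnegative integral be evaluated later as an
  ordinary expectation.\<close>

lemma KL_posterior_bounds:
  assumes \<rho>: "set_pmf \<rho> \<subseteq> Phi" and \<nu>: "set_pmf \<nu> \<subseteq> \<Union>(set_pmf \<rho>)"
    and x: "x \<in> set_pmf \<nu>" "ob \<in> set_pmf (Mdl (fst x) act)" and d: "d < 1"
    and q: "\<And>A. A \<in> set_pmf \<rho> \<Longrightarrow> (1 - d) * posterior Phi Mdl \<nu> act ob A \<le> q A"
  defines "H \<equiv> \<Sum>A\<in>set_pmf \<rho>. posterior Phi Mdl \<nu> act ob A * (ln (q A) - ln (pmf \<rho> A))"
  shows "e2ennreal (KL_Phi Phi (posterior Phi Mdl \<nu> act ob) \<rho>) \<le> ennreal (H - ln (1 - d))"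
    and "0 \<le> H - ln (1 - d)"
proof -
  let ?post = "posterior Phi Mdl \<nu> act ob"
  let ?k = "\<Sum>A\<in>set_pmf \<rho>. ?post A * ln (?post A / pmf \<rho> A)"
  have fin: "finite (set_pmf \<rho>)" using \<rho> finite_Phi finite_subset by blast
  have "KL_Phi Phi ?post \<rho> = (\<Sum>A\<in>set_pmf \<rho>. if ?post A = 0 then 0
         else if pmf \<rho> A = 0 then \<infinity> else ereal (?post A * ln (?post A / pmf \<rho> A)))"
    unfolding KL_Phi_def using \<rho> finite_Phi posterior_support(2)[OF \<rho> \<nu>]
    by (intro sum.mono_neutral_right) auto
  also have "\<dots> = (\<Sum>A\<in>set_pmf \<rho>. ereal (?post A * ln (?post A / pmf \<rho> A)))"
    by (intro sum.cong) (auto simp: set_pmf_iff)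
  finally have KL: "KL_Phi Phi ?post \<rho> = ereal ?k" by simp
  have sum\<rho>: "sum (pmf \<rho>) (set_pmf \<rho>) \<le> 1" using fin by (simp add: sum_pmf_eq_1)
  note b = relative_entropy_bounds[OF fin, of ?post "pmf \<rho>" d q, OF _ posterior_support(4)[OF \<rho> \<nu> x] _ sum\<rho> d q]
  have "0 \<le> ?k" "?k \<le> H - ln (1 - d)"
    unfolding H_def using posterior_support(3)[OF \<rho> \<nu>] \<rho> by (intro b; auto simp: pmf_positive)+
  then show "e2ennreal (KL_Phi Phi ?post \<rho>) \<le> ennreal (H - ln (1 - d))" "0 \<le> H - ln (1 - d)"
    unfolding KL by (auto simp: e2ennreal_ereal intro: ennreal_leI)
qed

text \<open>Pointwise, KL is at most the posterior average of ln q - ln \<rho>, up to the price -ln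
  (1 - d) of q being only nearly as large as the posterior. By \<open>posterior_tower\<close> this
  average becomes, in \<nu>-mean, the value at the class of the drawn x, which is the term in the
  surrogate. The bound \<delta> makes the logarithms bounded and hence integrable.\<close>

lemma AIR_ge_surrogate:
  assumes \<rho>: "set_pmf \<rho> \<subseteq> Phi" and \<nu>: "set_pmf \<nu> \<subseteq> \<Union>(set_pmf \<rho>)" and p: "set_pmf p \<subseteq> Pol"
    and d: "d < 1" and \<delta>: "0 < \<delta>"
    and q: "\<And>a ob A. A \<in> set_pmf \<rho> \<Longrightarrow> (1 - d) * posterior Phi Mdl \<nu> a ob A \<le> q a ob A"
    and q_bounds: "\<And>a ob A. A \<in> set_pmf \<rho> \<Longrightarrow> \<delta> \<le> q a ob A \<and> q a ob A \<le> 1"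
  shows "ereal ((\<Sum>x\<in>\<Union>(set_pmf \<rho>). pmf \<nu> x * surrogate \<rho> (pmf p) q x) + ln (1 - d) / \<eta>) \<le> AIR Phi V Mdl \<rho> \<eta> p \<nu>"
proof -
  define X where "X = \<Union>(set_pmf \<rho>)"
  define h where "h a A ob = ln (q a ob A) - ln (pmf \<rho> A)" for a A ob
  define H where "H a ob = (\<Sum>A\<in>set_pmf \<rho>. posterior Phi Mdl \<nu> a ob A * h a A ob)" for a ob
  \<comment> \<open>\<open>H\<close> itself may be negative; the shifted version is nonnegative at
    all observations that can occur, so it can stand under a nonnegative integral.\<close>
  define H' where "H' a ob = H a ob - ln (1 - d)" for a ob
  define E where "E a x g = measure_pmf.expectation (Mdl (fst x) a) g"
    for a and x :: "'m \<times> 'p" and g :: "'o \<Rightarrow> real"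
  have fin: "finite (set_pmf \<rho>)" using \<rho> finite_Phi finite_subset by blast
  have finX: "finite X" unfolding X_def using \<rho> by (rule finite_Union_support)
  define B where "B = (\<Sum>A\<in>set_pmf \<rho>. - ln \<delta> + \<bar>ln (pmf \<rho> A)\<bar>)"
  have "\<delta> \<le> 1" using q_bounds set_pmf_not_empty[of \<rho>] by (meson all_not_in_conv order_trans)
  then have ln\<delta>: "0 \<le> - ln \<delta>" using \<delta> by simp
  have h: "\<bar>h a A ob\<bar> \<le> B" if A: "A \<in> set_pmf \<rho>" for a A ob
  proof -
    have "0 < q a ob A" using q_bounds[OF A, of a ob] \<delta> by simp
    then have "ln \<delta> \<le> ln (q a ob A)" "ln (q a ob A) \<le> 0" using q_bounds[OF A, of a ob] \<delta> by auto
    then have "\<bar>ln (q a ob A)\<bar> \<le> - ln \<delta>" by simp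
    then have "\<bar>h a A ob\<bar> \<le> - ln \<delta> + \<bar>ln (pmf \<rho> A)\<bar>" by (simp add: h_def)
    also have "\<dots> \<le> B" unfolding B_def using fin A ln\<delta> by (intro member_le_sum) auto
    finally show ?thesis .
  qed
  note tower = posterior_tower[where Q="set_pmf \<rho>" and cls=cls and \<nu>="pmf \<nu>" and B=B,
      OF fin, OF _ pairwise_subset[OF Phi_disjoint \<rho>], folded X_def]
  have tower: "(\<Sum>x\<in>X. pmf \<nu> x * E a x (H a)) = (\<Sum>x\<in>X. pmf \<nu> x * E a x (h a (cls x)))" for a
    unfolding E_def H_def posterior_support(1)[OF \<rho> \<nu>]
    by (rule tower) (use \<rho> finite_class cls_eq h in auto)
  have H_bound: "\<bar>H' a ob\<bar> \<le> (\<Sum>A\<in>set_pmf \<rho>. B) + \<bar>ln (1 - d)\<bar>"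
    if x: "x \<in> set_pmf \<nu>" "ob \<in> set_pmf (Mdl (fst x) a)" for a ob x
  proof -
    have "\<bar>H a ob\<bar> \<le> (\<Sum>A\<in>set_pmf \<rho>. \<bar>posterior Phi Mdl \<nu> a ob A * h a A ob\<bar>)"
      unfolding H_def by (rule sum_abs)
    also have "\<dots> \<le> (\<Sum>A\<in>set_pmf \<rho>. B)"
    proof (rule sum_mono)
      fix A assume A: "A \<in> set_pmf \<rho>"
      have post0: "0 \<le> posterior Phi Mdl \<nu> a ob A'" if "A' \<in> set_pmf \<rho>" for A'
        using that \<rho> posterior_support(3)[OF \<rho> \<nu>] by blast
      have "posterior Phi Mdl \<nu> a ob A \<le> (\<Sum>A\<in>set_pmf \<rho>. posterior Phi Mdl \<nu> a ob A)"
        using A fin post0 by (intro member_le_sum) auto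
      then have "posterior Phi Mdl \<nu> a ob A \<le> 1" by (simp add: posterior_support(4)[OF \<rho> \<nu> x])
      then have "\<bar>posterior Phi Mdl \<nu> a ob A * h a A ob\<bar> \<le> 1 * B"
        unfolding abs_mult using post0[OF A] h[OF A] by (intro mult_mono) auto
      then show "\<bar>posterior Phi Mdl \<nu> a ob A * h a A ob\<bar> \<le> B" by simp
    qed
    finally show ?thesis unfolding H'_def by linarith
  qed
  have EH: "E a x (H' a) = E a x (H a) - ln (1 - d)" and H'_int: "integrable (measure_pmf (Mdl (fst x) a)) (H' a)"
    if x: "x \<in> set_pmf \<nu>" for a x
  proof -
    show int: "integrable (measure_pmf (Mdl (fst x) a)) (H' a)"
      using H_bound[OF x] by (rule integrable_pmf_bounded)
    then have "integrable (measure_pmf (Mdl (fst x) a)) (\<lambda>ob. H' a ob + ln (1 - d))" by simp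
    then have "integrable (measure_pmf (Mdl (fst x) a)) (H a)" by (simp add: H'_def)
    then show "E a x (H' a) = E a x (H a) - ln (1 - d)" unfolding E_def H'_def by simp
  qed
  note KLb = KL_posterior_bounds[OF \<rho> \<nu> _ _ d q, folded h_def, folded H_def, folded H'_def]
  define R where "R = (\<Sum>a\<in>Pol. pmf p a * (\<Sum>x\<in>X. pmf \<nu> x * E a x (H' a)))"
  have \<nu>X: "set_pmf \<nu> \<subseteq> X" using \<nu> by (simp add: X_def)
  have E0: "0 \<le> E a x (H' a)" if "x \<in> set_pmf \<nu>" for a x
    unfolding E_def using KLb(2)[OF that] by (intro integral_nonneg_AE) (auto simp: AE_measure_pmf_iff)
  note X_nn = nn_integral_measure_pmf_finite_real[OF finX \<nu>X, of "\<lambda>x. E a x (H' a)" for a, OF E0]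
  note P_nn = nn_integral_measure_pmf_finite_real[OF finite_Pol p, of "\<lambda>a. \<Sum>x\<in>X. pmf \<nu> x * E a x (H' a)", OF X_nn(2), folded R_def]
  have "(\<integral>\<^sup>+ \<omega>. e2ennreal (KL_Phi Phi (posterior Phi Mdl \<nu> (fst \<omega>) (snd (snd \<omega>))) \<rho>) \<partial>measure_pmf (air_joint Mdl p \<nu>))
    = (\<integral>\<^sup>+a. \<integral>\<^sup>+x. \<integral>\<^sup>+ob. e2ennreal (KL_Phi Phi (posterior Phi Mdl \<nu> a ob) \<rho>) \<partial>measure_pmf (Mdl (fst x) a) \<partial>measure_pmf \<nu> \<partial>measure_pmf p)"
    by (rule nn_integral_air_joint)
  also have "\<dots> \<le> (\<integral>\<^sup>+a. \<integral>\<^sup>+x. \<integral>\<^sup>+ob. ennreal (H' a ob) \<partial>measure_pmf (Mdl (fst x) a) \<partial>measure_pmf \<nu> \<partial>measure_pmf p)"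
    by (intro nn_integral_mono_AE) (use KLb(1) in \<open>auto simp: AE_measure_pmf_iff intro!: nn_integral_mono_AE\<close>)
  also have "\<dots> = (\<integral>\<^sup>+a. \<integral>\<^sup>+x. ennreal (E a x (H' a)) \<partial>measure_pmf \<nu> \<partial>measure_pmf p)"
    unfolding E_def using H'_int KLb(2)
    by (intro nn_integral_cong_AE AE_pmfI nn_integral_eq_integral) (auto simp: AE_measure_pmf_iff)
  also have "\<dots> = ennreal R"
    by (simp only: X_nn(1) P_nn(1))
  finally have "enn2ereal (\<integral>\<^sup>+ \<omega>. e2ennreal (KL_Phi Phi (posterior Phi Mdl \<nu> (fst \<omega>) (snd (snd \<omega>))) \<rho>) \<partial>measure_pmf (air_joint Mdl p \<nu>)) \<le> enn2ereal (ennreal R)"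
    by (simp only: less_eq_ennreal.rep_eq)
  also have "\<dots> = ereal R" using P_nn(2) by (simp add: enn2ereal_ennreal)
  finally have KL_le: "ereal (1 / \<eta>) * enn2ereal (\<integral>\<^sup>+ \<omega>. e2ennreal (KL_Phi Phi (posterior Phi Mdl \<nu> (fst \<omega>) (snd (snd \<omega>))) \<rho>) \<partial>measure_pmf (air_joint Mdl p \<nu>)) \<le> ereal (1 / \<eta>) * ereal R"
    using eta_pos by (intro ereal_mult_left_mono) auto
  define G where "G = (\<Sum>a\<in>Pol. pmf p a * (\<Sum>x\<in>X. pmf \<nu> x * (V (fst x) (snd x) - V (fst x) a)))"
  have G: "measure_pmf.expectation (air_joint Mdl p \<nu>) (\<lambda>(act, x, ob). V (fst x) (snd x) - V (fst x) act) = G"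
    unfolding G_def by (rule expectation_air_joint[OF finite_Pol p finX \<nu>X])
  have sum\<nu>: "sum (pmf \<nu>) X = 1" using finX \<nu>X by (rule sum_pmf_eq_1)
  have sump: "sum (pmf p) Pol = 1" using finite_Pol p by (rule sum_pmf_eq_1)
  have inner: "(\<Sum>x\<in>X. pmf \<nu> x * E a x (H' a)) = (\<Sum>x\<in>X. pmf \<nu> x * E a x (h a (cls x))) - ln (1 - d)" for a
  proof -
    have "(\<Sum>x\<in>X. pmf \<nu> x * E a x (H' a)) = (\<Sum>x\<in>X. pmf \<nu> x * E a x (H a) - pmf \<nu> x * ln (1 - d))"
    proof (rule sum.cong)
      fix x show "pmf \<nu> x * E a x (H' a) = pmf \<nu> x * E a x (H a) - pmf \<nu> x * ln (1 - d)"
        \<comment> \<open>\<open>EH\<close> is available only on the support of \<nu>; off it the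
          weight is 0.\<close>
        by (cases "x \<in> set_pmf \<nu>") (simp_all add: EH right_diff_distrib set_pmf_iff)
    qed simp
    then show ?thesis by (simp add: sum_subtractf tower sum\<nu> flip: sum_distrib_right)
  qed
  have R: "R = (\<Sum>a\<in>Pol. pmf p a * (\<Sum>x\<in>X. pmf \<nu> x * E a x (h a (cls x)))) - ln (1 - d)"
    unfolding R_def inner by (simp add: right_diff_distrib sum_subtractf sump flip: sum_distrib_right)
  have minus: "measure_pmf.expectation (Mdl (fst x) a) (\<lambda>ob. ln (pmf \<rho> (cls x)) - ln (q a ob (cls x))) = - E a x (h a (cls x))" for a x
    unfolding E_def h_def by (subst Bochner_Integration.integral_minus[symmetric]) simp
  have "(\<Sum>x\<in>X. pmf \<nu> x * surrogate \<rho> (pmf p) q x)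
      = (\<Sum>x\<in>X. \<Sum>a\<in>Pol. pmf p a * (pmf \<nu> x * (V (fst x) (snd x) - V (fst x) a) - 1 / \<eta> * (pmf \<nu> x * E a x (h a (cls x)))))"
    unfolding surrogate_def minus sum_distrib_left by (intro sum.cong refl) (simp add: algebra_simps)
  also have "\<dots> = (\<Sum>a\<in>Pol. pmf p a * (\<Sum>x\<in>X. pmf \<nu> x * (V (fst x) (snd x) - V (fst x) a) - 1 / \<eta> * (pmf \<nu> x * E a x (h a (cls x)))))"
    by (subst sum.swap) (simp only: sum_distrib_left)
  also have "\<dots> = G - 1 / \<eta> * (\<Sum>a\<in>Pol. pmf p a * (\<Sum>x\<in>X. pmf \<nu> x * E a x (h a (cls x))))"
    unfolding G_def sum_subtractf right_diff_distrib sum_distrib_left[symmetric]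
    by (simp add: sum_distrib_left mult.left_commute)
  finally have "(\<Sum>x\<in>X. pmf \<nu> x * surrogate \<rho> (pmf p) q x) + ln (1 - d) / \<eta> = G - 1 / \<eta> * R"
    unfolding R by (simp add: algebra_simps diff_divide_distrib)
  then have "ereal ((\<Sum>x\<in>X. pmf \<nu> x * surrogate \<rho> (pmf p) q x) + ln (1 - d) / \<eta>) = ereal G - ereal (1 / \<eta>) * ereal R"
    by simp
  also have "\<dots> \<le> AIR Phi V Mdl \<rho> \<eta> p \<nu>"
    unfolding AIR_def G by (rule ereal_minus_mono[OF order_refl KL_le])
  finally show ?thesis unfolding X_def .
qed

end

section \<open>Near-minimax pairs\<close>

lemma expectation_log_loss_convex:
  fixes f g :: "'a \<Rightarrow> real"
  assumes \<delta>: "0 < \<delta>" and f: "\<And>x. \<delta> \<le> f x \<and> f x \<le> 1" and g: "\<And>x. \<delta> \<le> g x \<and> g x \<le> 1"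
    and s: "0 \<le> s" "s \<le> 1"
  shows "measure_pmf.expectation M (\<lambda>x. r - ln (s * f x + (1 - s) * g x))
    \<le> s * measure_pmf.expectation M (\<lambda>x. r - ln (f x)) + (1 - s) * measure_pmf.expectation M (\<lambda>x. r - ln (g x))"
proof -
  have int: "integrable (measure_pmf M) (\<lambda>x. r - ln (k x))" if k: "\<And>x. \<delta> \<le> k x \<and> k x \<le> 1" for k
  proof (rule integrable_pmf_bounded)
    fix x
    have "ln \<delta> \<le> ln (k x)" "ln (k x) \<le> 0" using k[of x] \<delta> by auto
    then show "\<bar>r - ln (k x)\<bar> \<le> \<bar>r\<bar> + \<bar>ln \<delta>\<bar>" by linarith
  qed
  have mix: "\<delta> \<le> s * f x + (1 - s) * g x \<and> s * f x + (1 - s) * g x \<le> 1" for x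
  proof
    have "s * \<delta> + (1 - s) * \<delta> \<le> s * f x + (1 - s) * g x"
      using f g s by (intro add_mono mult_left_mono) auto
    then show "\<delta> \<le> s * f x + (1 - s) * g x" by (simp add: algebra_simps)
    show "s * f x + (1 - s) * g x \<le> 1"
      using f g s by (intro convex_bound_le) auto
  qed
  have "measure_pmf.expectation M (\<lambda>x. r - ln (s * f x + (1 - s) * g x))
     \<le> measure_pmf.expectation M (\<lambda>x. s * (r - ln (f x)) + (1 - s) * (r - ln (g x)))"
  proof (rule integral_mono)
    fix x
    have "s * ln (f x) + (1 - s) * ln (g x) \<le> ln (s * f x + (1 - s) * g x)"
      using f[of x] g[of x] \<delta> s by (intro ln_interpolate) auto
    then show "r - ln (s * f x + (1 - s) * g x) \<le> s * (r - ln (f x)) + (1 - s) * (r - ln (g x))"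
      by (simp add: algebra_simps)
  qed (intro int mix Bochner_Integration.integrable_add integrable_mult_right f g)+
  also have "\<dots> = s * measure_pmf.expectation M (\<lambda>x. r - ln (f x)) + (1 - s) * measure_pmf.expectation M (\<lambda>x. r - ln (g x))"
    using int[OF f] int[OF g] by (subst Bochner_Integration.integral_add) auto
  finally show ?thesis .
qed

lemma pmf_with_weights:
  fixes w :: "'a \<Rightarrow> real"
  assumes "finite A" "\<And>x. x \<in> A \<Longrightarrow> 0 \<le> w x" "sum w A = 1"
  obtains M where "set_pmf M \<subseteq> A" "\<And>x. x \<in> A \<Longrightarrow> pmf M x = w x"
proof -
  define f where "f x = (if x \<in> A then w x else 0)" for x
  have "(\<integral>\<^sup>+x. ennreal (f x) \<partial>count_space UNIV) = (\<Sum>x\<in>A. ennreal (f x))"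
    using assms by (intro nn_integral_count_space') (auto simp: f_def)
  also have "\<dots> = 1" using assms by (subst sum_ennreal) (auto simp: f_def)
  finally have "pmf (embed_pmf f) x = f x" for x
    using assms by (intro pmf_embed_pmf) (auto simp: f_def)
  then have "pmf (embed_pmf f) x = (if x \<in> A then w x else 0)" for x by (simp add: f_def)
  then show thesis by (intro that[of "embed_pmf f"]) (auto simp: set_pmf_iff split: if_splits)
qed

context restricted_class
begin

text \<open>The lower bound \<delta> keeps every log loss bounded, so that all the expectations in the
  surrogate are finite; it is lost in the limit.\<close>
definition candidates ::
  "('m \<times> 'p) set pmf \<Rightarrow> (('p \<Rightarrow> real) \<times> ('p \<Rightarrow> 'o \<Rightarrow> ('m \<times> 'p) set \<Rightarrow> real)) set" where
  "candidates \<rho> = {(p, q). (\<forall>a\<in>Pol. 0 \<le> p a) \<and> sum p Pol = 1 \<and>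
     (\<exists>\<delta>>0. \<forall>a ob. \<forall>A\<in>set_pmf \<rho>. \<delta> \<le> q a ob A) \<and> (\<forall>a ob. sum (q a ob) (set_pmf \<rho>) = 1)}"

lemma candidates_bounds:
  assumes \<rho>: "set_pmf \<rho> \<subseteq> Phi" and c: "(p, q) \<in> candidates \<rho>" and A: "A \<in> set_pmf \<rho>"
  shows "0 < q a ob A" "q a ob A \<le> 1"
proof -
  have pos: "0 < q a ob A'" if "A' \<in> set_pmf \<rho>" for A'
    using c that unfolding candidates_def by (auto intro: less_le_trans)
  then show "0 < q a ob A" using A .
  have "q a ob A \<le> sum (q a ob) (set_pmf \<rho>)"
    using A finite_subset[OF \<rho> finite_Phi] pos by (intro member_le_sum) (auto intro: less_imp_le)
  then show "q a ob A \<le> 1" using c by (auto simp: candidates_def)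
qed

text \<open>The products p(a) * loss(q a) are not jointly convex in (p, q), so averaging q with the
  constant weight t fails. Averaging it at each action with the share of \<open>c\<close> in the
  mixed probability repairs this: the mixed probability cancels the denominator, as for the
  perspective of a convex function.\<close>

lemma surrogate_convexlike:
  assumes \<rho>: "set_pmf \<rho> \<subseteq> Phi" and c: "c \<in> candidates \<rho>" and c': "c' \<in> candidates \<rho>"
    and t: "0 \<le> t" "t \<le> 1"
  shows "\<exists>e\<in>candidates \<rho>. \<forall>x\<in>\<Union>(set_pmf \<rho>).
    surrogate \<rho> (fst e) (snd e) x \<le> t * surrogate \<rho> (fst c) (snd c) x + (1 - t) * surrogate \<rho> (fst c') (snd c') x"
proof -
  obtain p q p' q' where cc: "c = (p, q)" "c' = (p', q')" by (cases c, cases c')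
  obtain \<delta>1 where \<delta>1: "\<delta>1 > 0" "\<And>a ob A. A \<in> set_pmf \<rho> \<Longrightarrow> \<delta>1 \<le> q a ob A"
    using c unfolding candidates_def cc by auto
  obtain \<delta>2 where \<delta>2: "\<delta>2 > 0" "\<And>a ob A. A \<in> set_pmf \<rho> \<Longrightarrow> \<delta>2 \<le> q' a ob A"
    using c' unfolding candidates_def cc by auto
  define \<delta> where "\<delta> = min \<delta>1 \<delta>2"
  have \<delta>: "0 < \<delta>" using \<delta>1 \<delta>2 by (simp add: \<delta>_def)
  have q: "\<delta> \<le> q a ob A \<and> q a ob A \<le> 1" if "A \<in> set_pmf \<rho>" for a ob A
    using \<delta>1(2)[OF that, of a ob] candidates_bounds(2)[OF \<rho> c[unfolded cc] that] by (auto simp: \<delta>_def)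
  have q': "\<delta> \<le> q' a ob A \<and> q' a ob A \<le> 1" if "A \<in> set_pmf \<rho>" for a ob A
    using \<delta>2(2)[OF that, of a ob] candidates_bounds(2)[OF \<rho> c'[unfolded cc] that] by (auto simp: \<delta>_def)
  have p0: "0 \<le> p a" "0 \<le> p' a" if "a \<in> Pol" for a
    using c c' that by (auto simp: cc candidates_def)
  define P where "P a = t * p a + (1 - t) * p' a" for a
  \<comment> \<open>If the mixed probability is 0, or the action lies outside \<open>Pol\<close>,
    the weight does not affect the surrogate. The value 0 keeps \<open>Q\<close> equal to
    \<open>q'\<close> there, as \<open>candidates\<close> constrains q at every action.\<close>
  define s where "s a = (if a \<in> Pol \<and> P a \<noteq> 0 then t * p a / P a else 0)" for a
  define Q where "Q a ob A = s a * q a ob A + (1 - s a) * q' a ob A" for a ob A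
  have P0: "0 \<le> P a" if "a \<in> Pol" for a using that p0 t by (simp add: P_def)
  have s01: "0 \<le> s a" "s a \<le> 1" for a
  proof -
    have "0 \<le> t * p a / P a \<and> t * p a / P a \<le> 1" if "a \<in> Pol" "P a \<noteq> 0"
    proof -
      have "0 \<le> t * p a" "0 \<le> (1 - t) * p' a" using p0[OF that(1)] t by auto
      moreover have "0 < P a" using P0[OF that(1)] that(2) by simp
      ultimately show ?thesis by (simp add: P_def)
    qed
    then show "0 \<le> s a" "s a \<le> 1" by (auto simp: s_def)
  qed
  have Ps: "P a * s a = t * p a" "P a * (1 - s a) = (1 - t) * p' a" if a: "a \<in> Pol" for a
  proof -
    show *: "P a * s a = t * p a"
    proof (cases "P a = 0")
      case True
      moreover have "0 \<le> t * p a" "0 \<le> (1 - t) * p' a" using p0[OF a] t by auto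
      ultimately have "t * p a = 0" unfolding P_def by linarith
      with True show ?thesis by simp
    qed (simp add: s_def a)
    then show "P a * (1 - s a) = (1 - t) * p' a" by (simp add: right_diff_distrib) (simp add: P_def)
  qed
  have "(P, Q) \<in> candidates \<rho>"
    unfolding candidates_def
  proof (safe intro!: P0)
    show "sum P Pol = 1"
      using c c' by (auto simp: P_def cc candidates_def sum.distrib simp flip: sum_distrib_left)
    show "sum (Q a ob) (set_pmf \<rho>) = 1" for a ob
      using c c' by (auto simp: Q_def cc candidates_def sum.distrib simp flip: sum_distrib_left)
    show "\<exists>\<delta>>0. \<forall>a ob. \<forall>A\<in>set_pmf \<rho>. \<delta> \<le> Q a ob A"
    proof (intro exI[of _ \<delta>] conjI \<delta> allI ballI)
      fix a ob A assume "A \<in> set_pmf \<rho>"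
      then have "s a * \<delta> + (1 - s a) * \<delta> \<le> Q a ob A"
        unfolding Q_def using q q' s01 by (intro add_mono mult_left_mono) auto
      then show "\<delta> \<le> Q a ob A" by (simp add: algebra_simps)
    qed
  qed
  moreover have "surrogate \<rho> P Q x \<le> t * surrogate \<rho> p q x + (1 - t) * surrogate \<rho> p' q' x"
    if x: "x \<in> \<Union>(set_pmf \<rho>)" for x
  proof -
    have A: "cls x \<in> set_pmf \<rho>" using x \<rho> cls_eq by (metis Union_iff subsetD)
    define J where "J q a = V (fst x) (snd x) - V (fst x) a
     + 1 / \<eta> * measure_pmf.expectation (Mdl (fst x) a) (\<lambda>ob. ln (pmf \<rho> (cls x)) - ln (q a ob (cls x)))" for q a
    have J: "J Q a \<le> s a * J q a + (1 - s a) * J q' a" for a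
    proof -
      let ?E = "\<lambda>q. measure_pmf.expectation (Mdl (fst x) a) (\<lambda>ob. ln (pmf \<rho> (cls x)) - ln (q a ob (cls x)))"
      have "?E Q \<le> s a * ?E q + (1 - s a) * ?E q'"
        unfolding Q_def using \<delta> q[OF A] q'[OF A] s01[of a] by (rule expectation_log_loss_convex)
      then have "1 / \<eta> * ?E Q \<le> 1 / \<eta> * (s a * ?E q + (1 - s a) * ?E q')"
        using eta_pos by (intro mult_left_mono) auto
      then show ?thesis unfolding J_def by (simp add: algebra_simps diff_divide_distrib)
    qed
    have "(\<Sum>a\<in>Pol. P a * J Q a) \<le> (\<Sum>a\<in>Pol. t * (p a * J q a) + (1 - t) * (p' a * J q' a))"
    proof (rule sum_mono)
      fix a assume a: "a \<in> Pol"
      have "P a * J Q a \<le> P a * (s a * J q a + (1 - s a) * J q' a)"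
        using J P0[OF a] by (rule mult_left_mono)
      also have "\<dots> = P a * s a * J q a + P a * (1 - s a) * J q' a" by (simp only: distrib_left mult.assoc)
      also have "\<dots> = t * (p a * J q a) + (1 - t) * (p' a * J q' a)" by (simp add: Ps[OF a])
      finally show "P a * J Q a \<le> t * (p a * J q a) + (1 - t) * (p' a * J q' a)" .
    qed
    then show ?thesis
      unfolding surrogate_def J_def[symmetric] by (simp add: sum.distrib sum_distrib_left)
  qed
  ultimately show ?thesis unfolding cc by (intro bexI[of _ "(P, Q)"]) auto
qed

text \<open>If every candidate fails somewhere, the weights of the alternative form a \<nu> whose
  average surrogate is at least W + \<epsilon> for all candidates. Smoothing the posterior of this
  same \<nu> gives one q that is a candidate together with any p. Hence the AIR at \<nu> is at least
  W + \<epsilon> / 2 for every p, against the assumption on W.\<close>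

lemma exists_approximate_candidate:
  assumes \<rho>: "set_pmf \<rho> \<subseteq> Phi" and ne: "\<Union>(set_pmf \<rho>) \<noteq> {}" and \<epsilon>: "\<epsilon> > 0"
    and W: "\<And>\<nu>. set_pmf \<nu> \<subseteq> \<Union>(set_pmf \<rho>) \<Longrightarrow> (INF p\<in>{p. set_pmf p \<subseteq> Pol}. AIR Phi V Mdl \<rho> \<eta> p \<nu>) \<le> ereal W"
  shows "\<exists>p q. (p, q) \<in> candidates \<rho> \<and> (\<forall>x\<in>\<Union>(set_pmf \<rho>). surrogate \<rho> p q x < W + \<epsilon>)"
proof (rule ccontr)
  assume neg: "\<not> ?thesis"
  define X where "X = \<Union>(set_pmf \<rho>)"
  define f where "f x c = surrogate \<rho> (fst c) (snd c) x - (W + \<epsilon>)" for x c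
  have finX: "finite X" unfolding X_def using \<rho> by (rule finite_Union_support)
  have fin: "finite (set_pmf \<rho>)" using \<rho> finite_Phi finite_subset by blast
  have "\<exists>w. (\<forall>x\<in>X. 0 \<le> w x) \<and> sum w X = 1 \<and> (\<forall>c\<in>candidates \<rho>. 0 \<le> (\<Sum>x\<in>X. w x * f x c))"
  proof (rule finite_family_alternative[OF finX])
    show "\<exists>e\<in>candidates \<rho>. \<forall>x\<in>X. f x e \<le> t * f x c + (1 - t) * f x c'"
      if "c \<in> candidates \<rho>" "c' \<in> candidates \<rho>" "0 \<le> t" "t \<le> 1" for c c' t
      using surrogate_convexlike[OF \<rho> that] unfolding X_def f_def by (simp add: algebra_simps)
    show "\<not> (\<exists>c\<in>candidates \<rho>. \<forall>x\<in>X. f x c < 0)"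
      using neg unfolding X_def f_def by (metis diff_less_0_iff_less prod.collapse)
  qed (use ne in \<open>simp add: X_def\<close>)
  then obtain w where w: "\<And>x. x \<in> X \<Longrightarrow> 0 \<le> w x" "sum w X = 1"
    "\<And>c. c \<in> candidates \<rho> \<Longrightarrow> 0 \<le> (\<Sum>x\<in>X. w x * f x c)" by blast
  obtain \<nu> where \<nu>: "set_pmf \<nu> \<subseteq> X" "\<And>x. x \<in> X \<Longrightarrow> pmf \<nu> x = w x"
    using pmf_with_weights[OF finX w(1,2)] by blast
  \<comment> \<open>Chosen so that smoothing costs exactly \<epsilon> / 2 in
    \<open>AIR_ge_surrogate\<close>.\<close>
  define d where "d = 1 - exp (- \<eta> * \<epsilon> / 2)"
  have d: "0 < d" "d < 1" and lnd: "ln (1 - d) / \<eta> = - \<epsilon> / 2"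
    using eta_pos \<epsilon> by (auto simp: d_def)
  let ?post = "posterior Phi Mdl \<nu>"
  define N where "N = real (card (set_pmf \<rho>))"
  have N: "N > 0" unfolding N_def using fin set_pmf_not_empty by (simp add: card_gt_0_iff)
  define T where "T a ob = (\<Sum>A\<in>set_pmf \<rho>. ?post a ob A)" for a ob
  \<comment> \<open>The mass missing from the scaled posterior is spread evenly over the support of
    \<rho>. At observations where the posterior is identically 0 the same formula gives the uniform
    distribution.\<close>
  define q where "q a ob A = (1 - d) * ?post a ob A + (1 - (1 - d) * T a ob) / N" for a ob A
  have \<nu>': "set_pmf \<nu> \<subseteq> \<Union>(set_pmf \<rho>)" using \<nu> by (simp add: X_def)
  have T1: "T a ob \<le> 1" for a ob
    unfolding T_def posterior_support(1)[OF \<rho> \<nu>'] by (simp flip: sum_divide_distrib)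
  have pad: "d / N \<le> (1 - (1 - d) * T a ob) / N" for a ob
  proof (rule divide_right_mono)
    have "(1 - d) * T a ob \<le> (1 - d) * 1" using T1 d by (intro mult_left_mono) auto
    then show "d \<le> 1 - (1 - d) * T a ob" by simp
  qed (use N in simp)
  have dN: "0 < d / N" using d N by simp
  have q_post: "(1 - d) * ?post a ob A \<le> q a ob A" for a ob A
    unfolding q_def using pad[of a ob] dN by linarith
  have q_pos: "d / N \<le> q a ob A" if "A \<in> set_pmf \<rho>" for a ob A
  proof -
    have "0 \<le> (1 - d) * ?post a ob A"
      using posterior_support(3)[OF \<rho> \<nu>'] that \<rho> d by (intro mult_nonneg_nonneg) auto
    then show ?thesis unfolding q_def using pad[of a ob] by linarith
  qed
  have q_sum: "sum (q a ob) (set_pmf \<rho>) = 1" for a ob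
    using N by (simp add: q_def sum.distrib T_def[symmetric] N_def[symmetric] flip: sum_distrib_left)
  have "ereal (W + \<epsilon> / 2) \<le> AIR Phi V Mdl \<rho> \<eta> p \<nu>" if p: "set_pmf p \<subseteq> Pol" for p
  proof -
    have cand: "(pmf p, q) \<in> candidates \<rho>"
      unfolding candidates_def using finite_Pol p q_pos q_sum dN by (auto simp: sum_pmf_eq_1)
    have "0 \<le> (\<Sum>x\<in>X. w x * f x (pmf p, q))" using w(3)[OF cand] .
    also have "\<dots> = (\<Sum>x\<in>X. pmf \<nu> x * surrogate \<rho> (pmf p) q x) - (W + \<epsilon>)"
      by (simp add: f_def \<nu>(2) right_diff_distrib sum_subtractf w(2) flip: sum_distrib_right)
    finally have "W + \<epsilon> / 2 \<le> (\<Sum>x\<in>X. pmf \<nu> x * surrogate \<rho> (pmf p) q x) + ln (1 - d) / \<eta>"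
      by (simp add: lnd)
    also have "ereal \<dots> \<le> AIR Phi V Mdl \<rho> \<eta> p \<nu>"
      unfolding X_def using q_post q_pos candidates_bounds(2)[OF \<rho> cand] \<rho> \<nu>' p d dN
      by (intro AIR_ge_surrogate[where \<delta> = "d / N"]) auto
    finally show ?thesis by simp
  qed
  then have "ereal (W + \<epsilon> / 2) \<le> (INF p\<in>{p. set_pmf p \<subseteq> Pol}. AIR Phi V Mdl \<rho> \<eta> p \<nu>)"
    by (intro INF_greatest) auto
  also have "\<dots> \<le> ereal W" using W \<nu>' by blast
  finally show False using \<epsilon> by simp
qed
end

section \<open>Limits of near-minimax pairs\<close>

text \<open>Losses are nonnegative but have no common bound, so Fatou replaces dominated convergence
  and yields an inequality only. Positivity of \<open>g\<close> is a separate conclusion: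
  \<open>ln 0\<close> is a real number in HOL, so a zero of \<open>g\<close> would not show up in
  the expectation.\<close>

lemma expectation_log_loss_limit:
  fixes f :: "nat \<Rightarrow> 'a \<Rightarrow> real"
  assumes f: "\<And>n x. x \<in> set_pmf M \<Longrightarrow> 0 < f n x \<and> f n x \<le> 1"
    and int: "\<And>n. integrable (measure_pmf M) (\<lambda>x. ln (f n x))"
    and lim: "\<And>x. x \<in> set_pmf M \<Longrightarrow> (\<lambda>n. f n x) \<longlonglongrightarrow> g x"
    and lim_E: "(\<lambda>n. - measure_pmf.expectation M (\<lambda>x. ln (f n x))) \<longlonglongrightarrow> l"
  shows "x \<in> set_pmf M \<Longrightarrow> 0 < g x"
    and "integrable (measure_pmf M) (\<lambda>x. ln (g x))"
    and "- measure_pmf.expectation M (\<lambda>x. ln (g x)) \<le> l"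
proof -
  define u where "u n x = ennreal (- ln (f n x))" for n x
  have g01: "0 \<le> g x \<and> g x \<le> 1" if x: "x \<in> set_pmf M" for x
    using LIMSEQ_le_const[OF lim[OF x], of 0] LIMSEQ_le_const2[OF lim[OF x], of 1] f[OF x]
    by (auto intro: less_imp_le)
  have l0: "0 \<le> l"
  proof (rule LIMSEQ_le_const[OF lim_E])
    have "0 \<le> - measure_pmf.expectation M (\<lambda>x. ln (f n x))" for n
      unfolding Bochner_Integration.integral_minus[symmetric] using f
      by (intro integral_nonneg_AE AE_pmfI) auto
    then show "\<exists>N. \<forall>n\<ge>N. 0 \<le> - measure_pmf.expectation M (\<lambda>x. ln (f n x))" by blast
  qed
  have u_int: "(\<integral>\<^sup>+x. u n x \<partial>measure_pmf M) = ennreal (- measure_pmf.expectation M (\<lambda>x. ln (f n x)))" for n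
    unfolding u_def Bochner_Integration.integral_minus[symmetric] using f int
    by (intro nn_integral_eq_integral AE_pmfI) auto
  have "(\<integral>\<^sup>+x. liminf (\<lambda>n. u n x) \<partial>measure_pmf M) \<le> liminf (\<lambda>n. \<integral>\<^sup>+x. u n x \<partial>measure_pmf M)"
    by (intro nn_integral_liminf) auto
  also have "(\<lambda>n. \<integral>\<^sup>+x. u n x \<partial>measure_pmf M) \<longlonglongrightarrow> ennreal l"
    unfolding u_int by (intro tendsto_ennrealI lim_E)
  then have "liminf (\<lambda>n. \<integral>\<^sup>+x. u n x \<partial>measure_pmf M) = ennreal l"
    by (rule lim_imp_Liminf[rotated]) simp
  finally have fatou: "(\<integral>\<^sup>+x. liminf (\<lambda>n. u n x) \<partial>measure_pmf M) \<le> ennreal l" .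
  \<comment> \<open>At a zero of \<open>g\<close> the losses diverge. Every point of the support has
    positive mass, so a single such point would make the Fatou integral infinite.\<close>
  have top: "liminf (\<lambda>n. u n x) = \<infinity>" if x: "x \<in> set_pmf M" "g x = 0" for x
  proof -
    have "filterlim (\<lambda>n. f n x) (at_right 0) sequentially"
      using lim[OF x(1)] f[OF x(1)] x(2) by (intro tendsto_imp_filterlim_at_right) auto
    then have "filterlim (\<lambda>n. ln (f n x)) at_bot sequentially"
      by (rule filterlim_compose[OF ln_at_0])
    then have at_top: "filterlim (\<lambda>n. - ln (f n x)) at_top sequentially"
      by (simp add: filterlim_uminus_at_top)
    then have "(\<lambda>n. u n x) \<longlonglongrightarrow> top" unfolding u_def by (simp add: ennreal_tendsto_top_eq_at_top)
    then show ?thesis by (subst lim_imp_Liminf) auto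
  qed
  have "AE x in measure_pmf M. liminf (\<lambda>n. u n x) \<noteq> \<infinity>"
  proof (rule nn_integral_PInf_AE)
    show "(\<integral>\<^sup>+x. liminf (\<lambda>n. u n x) \<partial>measure_pmf M) \<noteq> \<infinity>"
      using fatou by (auto simp: top_unique)
  qed simp
  then show pos: "0 < g x" if "x \<in> set_pmf M" for x
    using that top g01[OF that] by (force simp: AE_measure_pmf_iff less_le)
  have "(\<lambda>n. u n x) \<longlonglongrightarrow> ennreal (- ln (g x))" if x: "x \<in> set_pmf M" for x
    unfolding u_def using lim[OF x] pos[OF x] by (intro tendsto_ennrealI tendsto_minus tendsto_ln) auto
  then have "liminf (\<lambda>n. u n x) = ennreal (- ln (g x))" if "x \<in> set_pmf M" for x
    using that by (subst lim_imp_Liminf) auto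
  then have "(\<integral>\<^sup>+x. ennreal (- ln (g x)) \<partial>measure_pmf M) = (\<integral>\<^sup>+x. liminf (\<lambda>n. u n x) \<partial>measure_pmf M)"
    by (intro nn_integral_cong_AE AE_pmfI) simp
  with fatou have le: "(\<integral>\<^sup>+x. ennreal (- ln (g x)) \<partial>measure_pmf M) \<le> ennreal l" by simp
  have g0: "AE x in measure_pmf M. 0 \<le> - ln (g x)" using pos g01 by (intro AE_pmfI) auto
  have int_g: "integrable (measure_pmf M) (\<lambda>x. - ln (g x))"
    using g0 le by (intro integrableI_nonneg) (auto intro: le_less_trans)
  then show "integrable (measure_pmf M) (\<lambda>x. ln (g x))" by simp
  have "ennreal (- measure_pmf.expectation M (\<lambda>x. ln (g x))) \<le> ennreal l"
    using le nn_integral_eq_integral[OF int_g g0] by simp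
  then show "- measure_pmf.expectation M (\<lambda>x. ln (g x)) \<le> l" using l0 by (simp add: ennreal_le_iff)
qed

context restricted_class
begin

text \<open>The products p(a) * loss are made to converge rather than the losses, which need not be
  bounded for policies whose probability tends to 0.\<close>
lemma exists_limit_pair:
  assumes \<rho>: "set_pmf \<rho> \<subseteq> Phi" and ne: "\<Union>(set_pmf \<rho>) \<noteq> {}"
    and W: "\<And>\<nu>. set_pmf \<nu> \<subseteq> \<Union>(set_pmf \<rho>) \<Longrightarrow> (INF p\<in>{p. set_pmf p \<subseteq> Pol}. AIR Phi V Mdl \<rho> \<eta> p \<nu>) \<le> ereal W"
  shows "\<exists>p q. (\<forall>a\<in>Pol. 0 \<le> p a) \<and> sum p Pol = 1 \<and>
    (\<forall>a\<in>Pol. \<forall>ob. (\<forall>A\<in>set_pmf \<rho>. 0 \<le> q a ob A) \<and> sum (q a ob) (set_pmf \<rho>) = 1) \<and>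
    (\<forall>x\<in>\<Union>(set_pmf \<rho>). surrogate \<rho> p q x \<le> W \<and>
      (\<forall>a\<in>Pol. 0 < p a \<longrightarrow> (\<forall>ob\<in>set_pmf (Mdl (fst x) a). 0 < q a ob (cls x)) \<and>
         integrable (measure_pmf (Mdl (fst x) a)) (\<lambda>ob. ln (q a ob (cls x)))))"
proof -
  define X where "X = \<Union>(set_pmf \<rho>)"
  have finX: "finite X" unfolding X_def using \<rho> by (rule finite_Union_support)
  have fin: "finite (set_pmf \<rho>)" using \<rho> finite_Phi finite_subset by blast
  have cls_in: "cls x \<in> set_pmf \<rho>" if "x \<in> X" for x unfolding X_def using that \<rho> cls_eq by (metis X_def Union_iff subsetD)
  have "\<forall>n. \<exists>c. c \<in> candidates \<rho> \<and> (\<forall>x\<in>X. surrogate \<rho> (fst c) (snd c) x < W + 1 / real (Suc n))"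
    using exists_approximate_candidate[OF \<rho> ne _ W] unfolding X_def by fastforce
  then obtain c where c: "\<And>n. c n \<in> candidates \<rho>"
    "\<And>n x. x \<in> X \<Longrightarrow> surrogate \<rho> (fst (c n)) (snd (c n)) x < W + 1 / real (Suc n)" by metis
  define p where "p n = fst (c n)" for n
  define q where "q n = snd (c n)" for n
  have cand: "(p n, q n) \<in> candidates \<rho>" for n using c(1) by (simp add: p_def q_def)
  have surr: "surrogate \<rho> (p n) (q n) x < W + 1 / real (Suc n)" if "x \<in> X" for n x
    using c(2)[OF that] by (simp add: p_def q_def)
  have p0: "0 \<le> p n a" if "a \<in> Pol" for n a using cand[of n] that by (simp add: candidates_def)
  have p_sum: "sum (p n) Pol = 1" for n using cand[of n] by (simp add: candidates_def)
  have q_sum: "sum (q n a ob) (set_pmf \<rho>) = 1" for n a ob using cand[of n] by (simp add: candidates_def)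
  note q_bounds = candidates_bounds[OF \<rho> cand]
  have p1: "p n a \<le> 1" if "a \<in> Pol" for n a
    using p_sum[of n] member_le_sum[of a Pol "p n"] that p0 finite_Pol by auto
  define L where "L n x a = - measure_pmf.expectation (Mdl (fst x) a) (\<lambda>ob. ln (q n a ob (cls x)))" for n x a
  have int: "integrable (measure_pmf (Mdl (fst x) a)) (\<lambda>ob. ln (q n a ob (cls x)))" if x: "x \<in> X" for n x a
  proof -
    obtain \<delta> where \<delta>: "\<delta> > 0" "\<And>a ob. \<delta> \<le> q n a ob (cls x)"
      using cand[of n] cls_in[OF x] unfolding candidates_def by auto
    show ?thesis
    proof (rule integrable_pmf_bounded)
      fix ob
      have "ln \<delta> \<le> ln (q n a ob (cls x))" using \<delta>(1) \<delta>(2)[of a ob] by simp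
      moreover have "ln (q n a ob (cls x)) \<le> 0"
        using q_bounds[OF cls_in[OF x], of n a ob] by simp
      ultimately show "\<bar>ln (q n a ob (cls x))\<bar> \<le> - ln \<delta>" by linarith
    qed
  qed
  have L0: "0 \<le> L n x a" if x: "x \<in> X" for n x a
    unfolding L_def Bochner_Integration.integral_minus[symmetric]
    using q_bounds[OF cls_in[OF x], of n a] by (intro integral_nonneg_AE AE_pmfI) (simp add: ln_le_zero_iff)
  \<comment> \<open>Splitting the log ratio needs integrability, which the limit will have only at
    actions of positive probability; at the others both sides vanish.\<close>
  have expand: "surrogate \<rho> P Q x = (\<Sum>a\<in>Pol. P a * (V (fst x) (snd x) - V (fst x) a + 1 / \<eta> * ln (pmf \<rho> (cls x))))
       + 1 / \<eta> * (\<Sum>a\<in>Pol. P a * - measure_pmf.expectation (Mdl (fst x) a) (\<lambda>ob. ln (Q a ob (cls x))))"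
    if "\<And>a. a \<in> Pol \<Longrightarrow> P a \<noteq> 0 \<Longrightarrow> integrable (measure_pmf (Mdl (fst x) a)) (\<lambda>ob. ln (Q a ob (cls x)))" for P Q x
    unfolding surrogate_def sum_distrib_left sum.distrib[symmetric]
  proof (rule sum.cong)
    fix a assume a: "a \<in> Pol"
    show "P a * (V (fst x) (snd x) - V (fst x) a + 1 / \<eta> * measure_pmf.expectation (Mdl (fst x) a) (\<lambda>ob. ln (pmf \<rho> (cls x)) - ln (Q a ob (cls x))))
       = P a * (V (fst x) (snd x) - V (fst x) a + 1 / \<eta> * ln (pmf \<rho> (cls x)))
         + 1 / \<eta> * (P a * - measure_pmf.expectation (Mdl (fst x) a) (\<lambda>ob. ln (Q a ob (cls x))))"
    proof (cases "P a = 0")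
      case False
      then show ?thesis using that[OF a] by (simp add: algebra_simps diff_divide_distrib)
    qed simp
  qed simp
  define b where "b n x a = p n a * L n x a" for n x a
  define D where "D P x = (\<Sum>a\<in>Pol. P a * (V (fst x) (snd x) - V (fst x) a + 1 / \<eta> * ln (pmf \<rho> (cls x))))" for P and x :: "'m \<times> 'p"
  have surr_eq: "surrogate \<rho> (p n) (q n) x = D (p n) x + 1 / \<eta> * (\<Sum>a\<in>Pol. b n x a)" if "x \<in> X" for n x
    using expand[of "p n" x "q n"] int[OF that] by (simp add: D_def b_def L_def)
  have b0: "0 \<le> b n x a" if "x \<in> X" "a \<in> Pol" for n x a
    unfolding b_def using p0 L0 that by simp
  have XP: "fst x \<in> Ms" "snd x \<in> Pol" if "x \<in> X" for x
    using that \<rho> Phi_subset by (fastforce simp: X_def)+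
  \<comment> \<open>Gains are at least -1 and 1 / (n + 1) is at most 1, whence the 2 beside |W|.
    Multiplying the surrogate bound by \<eta> then bounds the sum of the nonnegative products, and
    so each of them. The leading 1 lets \<open>B\<close> also bound the probabilities.\<close>
  define B where "B = 1 + \<eta> * (\<bar>W\<bar> + 2) + (\<Sum>A\<in>set_pmf \<rho>. \<bar>ln (pmf \<rho> A)\<bar>)"
  have b_le: "b n x a \<le> B" if x: "x \<in> X" and a: "a \<in> Pol" for n x a
  proof -
    have "- 1 + 1 / \<eta> * ln (pmf \<rho> (cls x)) = (\<Sum>a\<in>Pol. p n a * (- 1 + 1 / \<eta> * ln (pmf \<rho> (cls x))))"
      by (simp add: p_sum flip: sum_distrib_right)
    also have "\<dots> \<le> D (p n) x"
      unfolding D_def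
    proof (intro sum_mono mult_left_mono p0)
      fix a assume "a \<in> Pol"
      then show "- 1 + 1 / \<eta> * ln (pmf \<rho> (cls x)) \<le> V (fst x) (snd x) - V (fst x) a + 1 / \<eta> * ln (pmf \<rho> (cls x))"
        using V_bounds[OF XP(1)[OF x] \<open>a \<in> Pol\<close>] V_bounds[OF XP[OF x]] by simp
    qed
    finally have "1 / \<eta> * (\<Sum>a\<in>Pol. b n x a) \<le> W + 1 / real (Suc n) + 1 - 1 / \<eta> * ln (pmf \<rho> (cls x))"
      using surr[OF x, of n] surr_eq[OF x, of n] by simp
    moreover have "1 / real (Suc n) \<le> 1" by simp
    ultimately have "1 / \<eta> * (\<Sum>a\<in>Pol. b n x a) \<le> (\<bar>W\<bar> + 2) - 1 / \<eta> * ln (pmf \<rho> (cls x))"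
      by linarith
    then have "(\<Sum>a\<in>Pol. b n x a) \<le> \<eta> * (\<bar>W\<bar> + 2) - ln (pmf \<rho> (cls x))"
      using eta_pos by (simp add: field_simps)
    moreover have "\<bar>ln (pmf \<rho> (cls x))\<bar> \<le> (\<Sum>A\<in>set_pmf \<rho>. \<bar>ln (pmf \<rho> A)\<bar>)"
      using fin cls_in[OF x] by (intro member_le_sum) auto
    moreover have "b n x a \<le> (\<Sum>a\<in>Pol. b n x a)"
      using a b0[OF x] finite_Pol by (intro member_le_sum) auto
    ultimately show ?thesis by (simp add: B_def)
  qed
  have B1: "1 \<le> B" using eta_pos by (simp add: B_def sum_nonneg)
  \<comment> \<open>Only observations possible under some x and some action matter. They form a
    countable set, as a diagonal argument requires, even if the observation type is
    uncountable.\<close>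
  define Ob where "Ob = (\<Union>x\<in>X. \<Union>a\<in>Pol. set_pmf (Mdl (fst x) a))"
  \<comment> \<open>The three families share one index set so that a single subsequence makes them
    all converge.\<close>
  define F where "F n i = (case i of Inl (a, ob, A) \<Rightarrow> q n a ob A | Inr (Inl a) \<Rightarrow> p n a | Inr (Inr (x, a)) \<Rightarrow> b n x a)" for n i
  define I where "I = Pol \<times> Ob \<times> set_pmf \<rho> <+> (Pol <+> X \<times> Pol)"
  have "countable I"
    unfolding I_def Ob_def using finite_Pol finX fin
    by (intro countable_Plus countable_SIGMA countable_UN) (auto intro: countable_finite)
  moreover have "norm (F n i) \<le> B" if "i \<in> I" for n i
  proof -
    have "\<bar>q n a ob A\<bar> \<le> B" if "A \<in> set_pmf \<rho>" for a ob A
      using q_bounds[OF that, of n a ob] B1 by simp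
    moreover have "\<bar>p n a\<bar> \<le> B" if "a \<in> Pol" for a using p0[OF that, of n] p1[OF that, of n] B1 by simp
    moreover have "\<bar>b n x a\<bar> \<le> B" if "x \<in> X" "a \<in> Pol" for x a using b0[OF that] b_le[OF that] by simp
    ultimately show ?thesis using that unfolding I_def F_def by auto
  qed
  ultimately obtain k where k: "strict_mono (k :: nat \<Rightarrow> nat)" "\<And>i. i \<in> I \<Longrightarrow> \<exists>l. (\<lambda>n. F (k n) i) \<longlonglongrightarrow> l"
    using function_convergent_subsequence[of I F B] by blast
  have conv: "(\<lambda>n. F (k n) i) \<longlonglongrightarrow> lim (\<lambda>n. F (k n) i)" if "i \<in> I" for i
    using k(2)[OF that] by (simp add: convergent_def convergent_LIMSEQ_iff[symmetric])
  define p' where "p' a = lim (\<lambda>n. p (k n) a)" for a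
  define b' where "b' x a = lim (\<lambda>n. b (k n) x a)" for x a
  \<comment> \<open>Convergence is not arranged outside \<open>Ob\<close>; the default there is
    \<rho>, which already sums to 1 on its support.\<close>
  define q' where "q' a ob A = (if ob \<in> Ob then lim (\<lambda>n. q (k n) a ob A) else pmf \<rho> A)" for a ob A
  have lim_p: "(\<lambda>n. p (k n) a) \<longlonglongrightarrow> p' a" if "a \<in> Pol" for a
  proof -
    have "Inr (Inl a) \<in> I" using that by (auto simp: I_def)
    from conv[OF this] show ?thesis by (simp add: F_def p'_def)
  qed
  have lim_b: "(\<lambda>n. b (k n) x a) \<longlonglongrightarrow> b' x a" if "x \<in> X" "a \<in> Pol" for x a
  proof -
    have "Inr (Inr (x, a)) \<in> I" using that by (auto simp: I_def)
    from conv[OF this] show ?thesis by (simp add: F_def b'_def)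
  qed
  have lim_q: "(\<lambda>n. q (k n) a ob A) \<longlonglongrightarrow> q' a ob A" if "a \<in> Pol" "ob \<in> Ob" "A \<in> set_pmf \<rho>" for a ob A
  proof -
    have "Inl (a, ob, A) \<in> I" using that by (auto simp: I_def)
    from conv[OF this] show ?thesis using that by (simp add: F_def q'_def)
  qed
  have p'0: "0 \<le> p' a" if "a \<in> Pol" for a
    using LIMSEQ_le_const[OF lim_p[OF that]] p0[OF that] by blast
  have p'_sum: "sum p' Pol = 1"
  proof (rule LIMSEQ_unique)
    show "(\<lambda>n. sum (p (k n)) Pol) \<longlonglongrightarrow> sum p' Pol" by (intro tendsto_sum lim_p)
  qed (simp add: p_sum)
  have b'0: "0 \<le> b' x a" if "x \<in> X" "a \<in> Pol" for x a
    using LIMSEQ_le_const[OF lim_b[OF that]] b0[OF that] by blast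
  have q'0: "0 \<le> q' a ob A" if "a \<in> Pol" "A \<in> set_pmf \<rho>" for a ob A
  proof (cases "ob \<in> Ob")
    case True
    then show ?thesis using LIMSEQ_le_const[OF lim_q[OF that(1) True that(2)]] q_bounds(1)[OF that(2)] less_imp_le by blast
  qed (simp add: q'_def)
  have q'_sum: "sum (q' a ob) (set_pmf \<rho>) = 1" if a: "a \<in> Pol" for a ob
  proof (cases "ob \<in> Ob")
    case True
    show ?thesis
    proof (rule LIMSEQ_unique)
      show "(\<lambda>n. sum (q (k n) a ob) (set_pmf \<rho>)) \<longlonglongrightarrow> sum (q' a ob) (set_pmf \<rho>)"
        by (intro tendsto_sum lim_q a True)
    qed (simp add: q_sum)
  next
    case False
    then show ?thesis using fin by (simp add: q'_def sum_pmf_eq_1)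
  qed
  \<comment> \<open>Where the limit probability is positive, dividing the convergent products by the
    convergent probabilities recovers convergence of the losses themselves.\<close>
  have log_loss: "(\<forall>ob\<in>set_pmf (Mdl (fst x) a). 0 < q' a ob (cls x)) \<and>
      integrable (measure_pmf (Mdl (fst x) a)) (\<lambda>ob. ln (q' a ob (cls x))) \<and>
      p' a * - measure_pmf.expectation (Mdl (fst x) a) (\<lambda>ob. ln (q' a ob (cls x))) \<le> b' x a"
    if x: "x \<in> X" and a: "a \<in> Pol" and pa: "0 < p' a" for x a
  proof -
    have ob: "ob \<in> Ob" if "ob \<in> set_pmf (Mdl (fst x) a)" for ob using that x a by (auto simp: Ob_def)
    have "(\<lambda>n. b (k n) x a / p (k n) a) \<longlonglongrightarrow> b' x a / p' a"
      using pa by (intro tendsto_divide lim_b lim_p x a) simp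
    moreover have "eventually (\<lambda>n. 0 < p (k n) a) sequentially"
      using order_tendstoD(1)[OF lim_p[OF a] pa] .
    then have "eventually (\<lambda>n. b (k n) x a / p (k n) a = L (k n) x a) sequentially"
      by eventually_elim (simp add: b_def)
    ultimately have "(\<lambda>n. L (k n) x a) \<longlonglongrightarrow> b' x a / p' a" by (rule Lim_transform_eventually)
    note * = expectation_log_loss_limit[where M = "Mdl (fst x) a" and f = "\<lambda>n ob. q (k n) a ob (cls x)" and g = "\<lambda>ob. q' a ob (cls x)",
        OF _ int[OF x] lim_q[OF a ob cls_in[OF x]] this[unfolded L_def]]
    from *[OF conjI[OF q_bounds[OF cls_in[OF x]]]] show ?thesis
      using pa by (auto simp: field_simps)
  qed
  have "surrogate \<rho> p' q' x \<le> W" if x: "x \<in> X" for x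
  proof -
    have "surrogate \<rho> p' q' x = D p' x + 1 / \<eta> * (\<Sum>a\<in>Pol. p' a * - measure_pmf.expectation (Mdl (fst x) a) (\<lambda>ob. ln (q' a ob (cls x))))"
      unfolding D_def using log_loss[OF x] p'0 by (intro expand) (auto simp: less_le)
    also have "\<dots> \<le> D p' x + 1 / \<eta> * (\<Sum>a\<in>Pol. b' x a)"
    proof (intro add_left_mono mult_left_mono sum_mono)
      fix a assume a: "a \<in> Pol"
      show "p' a * - measure_pmf.expectation (Mdl (fst x) a) (\<lambda>ob. ln (q' a ob (cls x))) \<le> b' x a"
        \<comment> \<open>At an action of limit probability 0 the products may keep a positive
          limit; the limit pair pays nothing there, so the inequality still holds.\<close>
        using log_loss[OF x a] b'0[OF x a] p'0[OF a] by (cases "p' a = 0") auto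
    qed (use eta_pos in simp)
    also have "\<dots> \<le> W"
    proof (rule LIMSEQ_le)
      show "(\<lambda>n. D (p (k n)) x + 1 / \<eta> * (\<Sum>a\<in>Pol. b (k n) x a)) \<longlonglongrightarrow> D p' x + 1 / \<eta> * (\<Sum>a\<in>Pol. b' x a)"
        unfolding D_def by (intro tendsto_intros lim_p lim_b x)
      have "(\<lambda>n. W + inverse (real (Suc n))) \<longlonglongrightarrow> W + 0"
        by (intro tendsto_add tendsto_const LIMSEQ_inverse_real_of_nat)
      from LIMSEQ_subseq_LIMSEQ[OF this k(1)]
      show "(\<lambda>n. W + 1 / real (Suc (k n))) \<longlonglongrightarrow> W" by (simp add: comp_def inverse_eq_divide)
      show "\<exists>N. \<forall>n\<ge>N. D (p (k n)) x + 1 / \<eta> * (\<Sum>a\<in>Pol. b (k n) x a) \<le> W + 1 / real (Suc (k n))"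
        using surr[OF x] surr_eq[OF x] by (metis less_imp_le)
    qed
    finally show ?thesis .
  qed
  then show ?thesis
    using p'0 p'_sum q'0 q'_sum log_loss unfolding X_def[symmetric]
    by (intro exI[of _ p'] exI[of _ q']) blast
qed

text \<open>Real functions become pmfs here, so that q can serve as the next \<rho>. The two clauses
  on q are what the induction over rounds requires: phi* keeps positive mass, and the log ratio can
  be split under the expectation.\<close>

lemma exists_minimax_pair:
  assumes \<rho>: "set_pmf \<rho> \<subseteq> Phi"
    and W: "\<And>\<nu>. set_pmf \<nu> \<subseteq> \<Union>(set_pmf \<rho>) \<Longrightarrow> (INF p\<in>{p. set_pmf p \<subseteq> Pol}. AIR Phi V Mdl \<rho> \<eta> p \<nu>) \<le> ereal W"
  shows "\<exists>p q. set_pmf p \<subseteq> Pol \<and> (\<forall>a ob. set_pmf (q a ob) \<subseteq> Phi) \<and>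
    (\<forall>x\<in>\<Union>(set_pmf \<rho>). surrogate \<rho> (pmf p) (\<lambda>a ob. pmf (q a ob)) x \<le> W \<and>
      (\<forall>a\<in>set_pmf p. (\<forall>ob\<in>set_pmf (Mdl (fst x) a). cls x \<in> set_pmf (q a ob)) \<and>
         integrable (measure_pmf (Mdl (fst x) a)) (\<lambda>ob. ln (pmf (q a ob) (cls x)))))"
proof (cases "\<Union>(set_pmf \<rho>) = {}")
  \<comment> \<open>This happens when \<rho> charges only the empty class, which \<open>Phi\<close>
    may contain. No x is left to satisfy anything.\<close>
  case True
  obtain a where "a \<in> Pol" using Pol_nonempty by blast
  then show ?thesis using True \<rho> by (intro exI[of _ "return_pmf a"] exI[of _ "\<lambda>_ _. \<rho>"]) auto
next
  case False
  have fin: "finite (set_pmf \<rho>)" using \<rho> finite_Phi finite_subset by blast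
  obtain p q where p: "\<And>a. a \<in> Pol \<Longrightarrow> 0 \<le> p a" "sum p Pol = 1"
    and q: "\<And>a ob A. a \<in> Pol \<Longrightarrow> A \<in> set_pmf \<rho> \<Longrightarrow> 0 \<le> q a ob A"
      "\<And>a ob. a \<in> Pol \<Longrightarrow> sum (q a ob) (set_pmf \<rho>) = 1"
    and pq: "\<forall>x\<in>\<Union>(set_pmf \<rho>). surrogate \<rho> p q x \<le> W \<and>
      (\<forall>a\<in>Pol. 0 < p a \<longrightarrow> (\<forall>ob\<in>set_pmf (Mdl (fst x) a). 0 < q a ob (cls x)) \<and>
         integrable (measure_pmf (Mdl (fst x) a)) (\<lambda>ob. ln (q a ob (cls x))))"
    using exists_limit_pair[OF \<rho> False W] by blast
  obtain P where P: "set_pmf P \<subseteq> Pol" "\<And>a. a \<in> Pol \<Longrightarrow> pmf P a = p a"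
    using pmf_with_weights[OF finite_Pol p] by blast
  \<comment> \<open>Actions outside \<open>Pol\<close> are never played, but q must be a pmf on
    \<open>Phi\<close> there too; any pmf on the support of \<rho> will do.\<close>
  have "\<exists>M. set_pmf M \<subseteq> set_pmf \<rho> \<and> (a \<in> Pol \<longrightarrow> (\<forall>A\<in>set_pmf \<rho>. pmf M A = q a ob A))" for a ob
  proof (cases "a \<in> Pol")
    case True
    then show ?thesis using pmf_with_weights[OF fin q(1)[OF True] q(2)[OF True]] by metis
  qed auto
  then obtain Q where Q: "\<And>a ob. set_pmf (Q a ob) \<subseteq> set_pmf \<rho>"
    "\<And>a ob A. a \<in> Pol \<Longrightarrow> A \<in> set_pmf \<rho> \<Longrightarrow> pmf (Q a ob) A = q a ob A" by metis
  have "surrogate \<rho> (pmf P) (\<lambda>a ob. pmf (Q a ob)) x \<le> W \<and>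
      (\<forall>a\<in>set_pmf P. (\<forall>ob\<in>set_pmf (Mdl (fst x) a). cls x \<in> set_pmf (Q a ob)) \<and>
         integrable (measure_pmf (Mdl (fst x) a)) (\<lambda>ob. ln (pmf (Q a ob) (cls x))))"
    if x: "x \<in> \<Union>(set_pmf \<rho>)" for x
  proof -
    have A: "cls x \<in> set_pmf \<rho>" using x \<rho> cls_eq by (metis Union_iff subsetD)
    have "surrogate \<rho> (pmf P) (\<lambda>a ob. pmf (Q a ob)) x = surrogate \<rho> p q x"
      unfolding surrogate_def by (intro sum.cong refl) (simp only: P(2) Q(2)[OF _ A])
    moreover have "(\<forall>ob\<in>set_pmf (Mdl (fst x) a). cls x \<in> set_pmf (Q a ob)) \<and>
         integrable (measure_pmf (Mdl (fst x) a)) (\<lambda>ob. ln (pmf (Q a ob) (cls x)))"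
      if a: "a \<in> set_pmf P" for a
    proof -
      have aPol: "a \<in> Pol" and "0 < p a" using a P pmf_positive[OF a] by auto
      then have "\<forall>ob\<in>set_pmf (Mdl (fst x) a). 0 < q a ob (cls x)"
        and "integrable (measure_pmf (Mdl (fst x) a)) (\<lambda>ob. ln (q a ob (cls x)))"
        using bspec[OF pq x] by blast+
      then show ?thesis
        unfolding set_pmf_iff[of "cls x"] Q(2)[OF aPol A] by (auto dest: bspec)
    qed
    ultimately show ?thesis using bspec[OF pq x] by simp
  qed
  then show ?thesis using P(1) Q(1) \<rho> by (intro exI[of _ P] exI[of _ Q]) blast
qed

end

section \<open>Telescoping over the rounds\<close>

text \<open>Supplies integrability of the continuation regret in the induction over rounds, and the
  contradiction when the max-max-min is minus infinity.\<close>

lemma exp_regret_bounded: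
  fixes V :: "'m \<Rightarrow> 'p \<Rightarrow> real"
  assumes V: "\<And>h a. a \<in> set_pmf (alg h) \<Longrightarrow> \<bar>V (fst (env h)) (snd (env h)) - V (fst (env h)) a\<bar> \<le> 1"
  shows "\<bar>exp_regret V Mdl alg env n h\<bar> \<le> real n"
proof -
  have pmf_le: "\<bar>measure_pmf.expectation M f\<bar> \<le> B" if "\<And>x. x \<in> set_pmf M \<Longrightarrow> \<bar>f x\<bar> \<le> B" for M :: "'z pmf" and f and B :: real
  proof -
    have "integrable (measure_pmf M) f" using that by (rule integrable_pmf_bounded)
    then have "\<bar>measure_pmf.expectation M f\<bar> \<le> measure_pmf.expectation M (\<lambda>x. \<bar>f x\<bar>)" "integrable (measure_pmf M) (\<lambda>x. \<bar>f x\<bar>)"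
      by (auto intro: integral_abs_bound)
    moreover have "measure_pmf.expectation M (\<lambda>x. \<bar>f x\<bar>) \<le> B"
      using calculation(2) that by (intro measure_pmf.integral_le_const AE_pmfI) auto
    ultimately show ?thesis by linarith
  qed
  show ?thesis
  proof (induction n arbitrary: h)
    case (Suc n)
    show ?case
      unfolding exp_regret.simps
    proof (rule pmf_le)
      fix a assume a: "a \<in> set_pmf (alg h)"
      have "\<bar>measure_pmf.expectation (Mdl (fst (env h)) a) (\<lambda>ob. exp_regret V Mdl alg env n (h @ [(a, ob)]))\<bar> \<le> real n"
        by (rule pmf_le) (rule Suc.IH)
      then show "\<bar>V (fst (env h)) (snd (env h)) - V (fst (env h)) a +
          measure_pmf.expectation (Mdl (fst (env h)) a) (\<lambda>ob. exp_regret V Mdl alg env n (h @ [(a, ob)]))\<bar> \<le> real (Suc n)"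
        using V[OF a] by simp
    qed
  qed simp
qed

context restricted_class
begin

lemma value_gap_bounded:
  assumes "phi \<in> Phi" "x \<in> phi" "a \<in> Pol"
  shows "\<bar>V (fst x) (snd x) - V (fst x) a\<bar> \<le> 1"
proof -
  have "fst x \<in> Ms" "snd x \<in> Pol" using Phi_subset assms by fastforce+
  then show ?thesis using V_bounds[of "fst x" "snd x"] V_bounds[of "fst x" a] assms by auto
qed

lemma regret_le_potential:
  fixes prior :: "('m \<times> 'p) set pmf"
  assumes step: "\<And>\<rho>. set_pmf \<rho> \<subseteq> Phi \<Longrightarrow> set_pmf (pol \<rho>) \<subseteq> Pol \<and> (\<forall>a ob. set_pmf (upd \<rho> a ob) \<subseteq> Phi) \<and>
    (\<forall>x\<in>\<Union>(set_pmf \<rho>). surrogate \<rho> (pmf (pol \<rho>)) (\<lambda>a ob. pmf (upd \<rho> a ob)) x \<le> W \<and>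
      (\<forall>a\<in>set_pmf (pol \<rho>). (\<forall>ob\<in>set_pmf (Mdl (fst x) a). cls x \<in> set_pmf (upd \<rho> a ob)) \<and>
         integrable (measure_pmf (Mdl (fst x) a)) (\<lambda>ob. ln (pmf (upd \<rho> a ob) (cls x)))))"
  defines "alg \<equiv> \<lambda>h. pol (foldl (\<lambda>\<rho> (a, ob). upd \<rho> a ob) prior h)"
  assumes prior: "set_pmf prior \<subseteq> Phi"
  shows "set_pmf (alg h) \<subseteq> Pol"
    and "phi \<in> Phi \<Longrightarrow> (\<And>h. env h \<in> phi) \<Longrightarrow> phi \<in> set_pmf prior \<Longrightarrow>
      exp_regret V Mdl alg env n [] \<le> real n * W - ln (pmf prior phi) / \<eta>"
proof -
  define st where "st h = foldl (\<lambda>\<rho> (a, ob). upd \<rho> a ob) prior h" for h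
  have st_snoc: "st (h @ [(a, ob)]) = upd (st h) a ob" for h a ob by (simp add: st_def)
  have st: "set_pmf (st h) \<subseteq> Phi" for h
  proof (induction h rule: rev_induct)
    case (snoc z h)
    then show ?case using step[of "st h"] by (cases z) (simp add: st_snoc)
  qed (simp add: st_def prior)
  have alg: "alg h = pol (st h)" for h by (simp add: alg_def st_def)
  show alg_Pol: "set_pmf (alg h) \<subseteq> Pol" for h using step[OF st[of h]] by (simp add: alg)
  assume phi: "phi \<in> Phi" and env: "\<And>h. env h \<in> phi" and init: "phi \<in> set_pmf prior"
  have bnd: "\<bar>exp_regret V Mdl alg env n h\<bar> \<le> real n" for n h
    using value_gap_bounded[OF phi env] alg_Pol by (intro exp_regret_bounded) blast
  have "phi \<in> set_pmf (st h) \<Longrightarrow> exp_regret V Mdl alg env n h \<le> real n * W - ln (pmf (st h) phi) / \<eta>" for h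
  proof (induction n arbitrary: h)
    case 0
    \<comment> \<open>The potential left at the end is nonnegative because probabilities are at most
      1, so it can be discarded.\<close>
    have "ln (pmf (st h) phi) \<le> 0" using pmf_le_1[of "st h" phi] pmf_positive[OF 0] by simp
    then show ?case using eta_pos by (simp add: divide_nonpos_pos)
  next
    case (Suc n)
    define x where "x = env h"
    define q where "q a ob = pmf (upd (st h) a ob) phi" for a ob
    have x: "x \<in> phi" "x \<in> \<Union>(set_pmf (st h))" using env Suc.prems by (auto simp: x_def)
    have cls: "cls x = phi" using cls_eq[OF phi x(1)] .
    have q_in: "phi \<in> set_pmf (st (h @ [(a, ob)]))" and q_int: "integrable (measure_pmf (Mdl (fst x) a)) (\<lambda>ob. ln (q a ob))"
      if "a \<in> set_pmf (alg h)" "ob \<in> set_pmf (Mdl (fst x) a)" for a ob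
      using step[OF st[of h]] x(2) that by (auto simp: alg st_snoc q_def cls dest!: bspec)
    define G where "G a = V (fst x) (snd x) - V (fst x) a" for a
    define E where "E a = measure_pmf.expectation (Mdl (fst x) a) (\<lambda>ob. ln (pmf (st h) phi) - ln (q a ob))" for a
    have step_le: "G a + measure_pmf.expectation (Mdl (fst x) a) (\<lambda>ob. exp_regret V Mdl alg env n (h @ [(a, ob)]))
        \<le> (G a + 1 / \<eta> * E a) + (real n * W - ln (pmf (st h) phi) / \<eta>)" if a: "a \<in> set_pmf (alg h)" for a
    proof -
      obtain ob where "ob \<in> set_pmf (Mdl (fst x) a)" using set_pmf_not_empty[of "Mdl (fst x) a"] by blast
      note int = q_int[OF a this]
      have "measure_pmf.expectation (Mdl (fst x) a) (\<lambda>ob. exp_regret V Mdl alg env n (h @ [(a, ob)]))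
        \<le> measure_pmf.expectation (Mdl (fst x) a) (\<lambda>ob. real n * W - ln (q a ob) / \<eta>)"
      proof (rule integral_mono_AE)
        show "integrable (measure_pmf (Mdl (fst x) a)) (\<lambda>ob. exp_regret V Mdl alg env n (h @ [(a, ob)]))"
          using bnd by (rule integrable_pmf_bounded)
        show "AE ob in measure_pmf (Mdl (fst x) a). exp_regret V Mdl alg env n (h @ [(a, ob)]) \<le> real n * W - ln (q a ob) / \<eta>"
          using Suc.IH[OF q_in[OF a]] by (intro AE_pmfI) (simp add: st_snoc q_def)
      qed (use int in simp)
      also have "\<dots> = 1 / \<eta> * E a + (real n * W - ln (pmf (st h) phi) / \<eta>)"
        unfolding E_def using int by (simp add: diff_divide_distrib)
      finally show ?thesis by simp
    qed
    have sum1: "sum (pmf (alg h)) Pol = 1" using finite_Pol alg_Pol by (rule sum_pmf_eq_1)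
    have "exp_regret V Mdl alg env (Suc n) h = (\<Sum>a\<in>Pol. pmf (alg h) a *
        (G a + measure_pmf.expectation (Mdl (fst x) a) (\<lambda>ob. exp_regret V Mdl alg env n (h @ [(a, ob)]))))"
      unfolding exp_regret.simps x_def[symmetric] G_def using finite_Pol alg_Pol
      by (subst integral_measure_pmf[of Pol]) auto
    also have "\<dots> \<le> (\<Sum>a\<in>Pol. pmf (alg h) a * ((G a + 1 / \<eta> * E a) + (real n * W - ln (pmf (st h) phi) / \<eta>)))"
    proof (rule sum_mono)
      fix a
      show "pmf (alg h) a * (G a + measure_pmf.expectation (Mdl (fst x) a) (\<lambda>ob. exp_regret V Mdl alg env n (h @ [(a, ob)])))
        \<le> pmf (alg h) a * ((G a + 1 / \<eta> * E a) + (real n * W - ln (pmf (st h) phi) / \<eta>))"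
        using step_le by (cases "a \<in> set_pmf (alg h)") (auto simp: set_pmf_iff intro!: mult_left_mono)
    qed
    also have "\<dots> = (\<Sum>a\<in>Pol. pmf (alg h) a * (G a + 1 / \<eta> * E a)) + (real n * W - ln (pmf (st h) phi) / \<eta>)"
      unfolding distrib_left[of "pmf (alg h) _" "G _ + _"] sum.distrib by (simp add: sum1 flip: sum_distrib_right)
    also have "(\<Sum>a\<in>Pol. pmf (alg h) a * (G a + 1 / \<eta> * E a)) \<le> W"
      using step[OF st[of h]] x(2) by (auto simp: surrogate_def G_def E_def q_def alg cls dest!: bspec)
    finally show ?case by (simp add: algebra_simps)
  qed
  from this[of "[]"] show "exp_regret V Mdl alg env n [] \<le> real n * W - ln (pmf prior phi) / \<eta>"
    using init by (simp add: st_def)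
qed

text \<open>The uniform start gives every class the same initial potential ln |Phi| / \<eta>, so one
  algorithm serves all phi*.\<close>

lemma exists_algorithm:
  assumes ne: "Phi \<noteq> {}"
    and W: "\<And>\<rho> \<nu>. set_pmf \<rho> \<subseteq> Phi \<Longrightarrow> set_pmf \<nu> \<subseteq> \<Union>(set_pmf \<rho>) \<Longrightarrow>
      (INF p\<in>{p. set_pmf p \<subseteq> Pol}. AIR Phi V Mdl \<rho> \<eta> p \<nu>) \<le> ereal W"
  obtains alg where "\<And>h. set_pmf (alg h) \<subseteq> Pol"
    "\<And>phi env. phi \<in> Phi \<Longrightarrow> (\<And>h. env h \<in> phi) \<Longrightarrow>
      exp_regret V Mdl alg env T [] \<le> ln (real (card Phi)) / \<eta> + real T * W"
proof -
  let ?good = "\<lambda>\<rho> p q. set_pmf p \<subseteq> Pol \<and> (\<forall>a ob. set_pmf (q a ob) \<subseteq> Phi) \<and>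
    (\<forall>x\<in>\<Union>(set_pmf \<rho>). surrogate \<rho> (pmf p) (\<lambda>a ob. pmf (q a ob)) x \<le> W \<and>
      (\<forall>a\<in>set_pmf p. (\<forall>ob\<in>set_pmf (Mdl (fst x) a). cls x \<in> set_pmf (q a ob)) \<and>
         integrable (measure_pmf (Mdl (fst x) a)) (\<lambda>ob. ln (pmf (q a ob) (cls x)))))"
  have "\<forall>\<rho>. \<exists>p q. set_pmf \<rho> \<subseteq> Phi \<longrightarrow> ?good \<rho> p q"
    using exists_minimax_pair[OF _ W] by blast
  then obtain pol upd where "\<And>\<rho>. set_pmf \<rho> \<subseteq> Phi \<Longrightarrow> ?good \<rho> (pol \<rho>) (upd \<rho>)" by metis
  note bound = regret_le_potential[OF this, where prior = "pmf_of_set Phi"]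
  have card: "card Phi > 0" using ne finite_Phi by (simp add: card_gt_0_iff)
  show thesis
  proof (rule that)
    show "set_pmf (pol (foldl (\<lambda>\<rho> (a, ob). upd \<rho> a ob) (pmf_of_set Phi) h)) \<subseteq> Pol" for h
      by (rule bound(1)) (auto simp: ne finite_Phi)
    fix phi and env :: "('p \<times> 'o) list \<Rightarrow> 'm \<times> 'p" assume "phi \<in> Phi" "\<And>h. env h \<in> phi"
    then show "exp_regret V Mdl (\<lambda>h. pol (foldl (\<lambda>\<rho> (a, ob). upd \<rho> a ob) (pmf_of_set Phi) h)) env T []
        \<le> ln (real (card Phi)) / \<eta> + real T * W"
      using bound(2)[of phi env T] card by (simp add: ne finite_Phi ln_div)
  qed
qed

end

theorem theorem1:
  fixes Ms :: "'m set" and Pol :: "'p set" and Phi :: "('m \<times> 'p) set set"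
    and Mdl :: "'m \<Rightarrow> 'p \<Rightarrow> 'o pmf" and V :: "'m \<Rightarrow> 'p \<Rightarrow> real"
    and \<eta> :: real and T :: nat
  assumes "finite Ms" and "finite Pol" and "Pol \<noteq> {}"
    and "\<And>M act. M \<in> Ms \<Longrightarrow> act \<in> Pol \<Longrightarrow> 0 \<le> V M act \<and> V M act \<le> 1"
    and "\<And>phi. phi \<in> Phi \<Longrightarrow> phi \<subseteq> Ms \<times> Pol"
    and "pairwise disjnt Phi"
    and "\<eta> > 0"
  shows "\<exists>alg :: ('p \<times> 'o) list \<Rightarrow> 'p pmf.
           (\<forall>h. set_pmf (alg h) \<subseteq> Pol) \<and>
           (\<forall>phistar \<in> Phi. \<forall>env :: ('p \<times> 'o) list \<Rightarrow> 'm \<times> 'p.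
              (\<forall>h. env h \<in> phistar) \<longrightarrow>
              ereal (exp_regret V Mdl alg env T [])
                \<le> ereal (ln (real (card Phi)) / \<eta>)
                  + ereal (real T) *
                    (SUP \<rho> \<in> {\<rho> :: ('m \<times> 'p) set pmf. set_pmf \<rho> \<subseteq> Phi}.
                       SUP \<nu> \<in> {\<nu> :: ('m \<times> 'p) pmf. set_pmf \<nu> \<subseteq> \<Union>Phi}.
                         INF p \<in> {p :: 'p pmf. set_pmf p \<subseteq> Pol}. AIR Phi V Mdl \<rho> \<eta> p \<nu>))"
proof -
  interpret restricted_class Ms Pol Phi Mdl V \<eta>
    by unfold_locales (use assms in blast)+
  define S where "S = (SUP \<rho> \<in> {\<rho> :: ('m \<times> 'p) set pmf. set_pmf \<rho> \<subseteq> Phi}.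
                       SUP \<nu> \<in> {\<nu> :: ('m \<times> 'p) pmf. set_pmf \<nu> \<subseteq> \<Union>Phi}.
                         INF p \<in> {p :: 'p pmf. set_pmf p \<subseteq> Pol}. AIR Phi V Mdl \<rho> \<eta> p \<nu>)"
  obtain a0 where a0: "a0 \<in> Pol" using Pol_nonempty by blast
  have "\<exists>alg :: ('p \<times> 'o) list \<Rightarrow> 'p pmf. (\<forall>h. set_pmf (alg h) \<subseteq> Pol) \<and>
     (\<forall>phi\<in>Phi. \<forall>env. (\<forall>h. env h \<in> phi) \<longrightarrow>
       ereal (exp_regret V Mdl alg env T []) \<le> ereal (ln (real (card Phi)) / \<eta>) + ereal (real T) * S)"
  \<comment> \<open>Cases in which playing a fixed policy suffices: no environment exists, no round
    is played, or the right-hand side is infinite. In \<open>ereal\<close>, 0 times infinity is 0,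
    so T = 0 must be examined before S = \<infinity>.\<close>
  proof (cases "\<Union>Phi = {} \<or> T = 0 \<or> S = \<infinity>")
    case True
    have "ereal (exp_regret V Mdl (\<lambda>_. return_pmf a0) env T []) \<le> ereal (ln (real (card Phi)) / \<eta>) + ereal (real T) * S"
      if phi: "phi \<in> Phi" and env: "\<forall>h. env h \<in> phi" for phi and env :: "('p \<times> 'o) list \<Rightarrow> 'm \<times> 'p"
    proof (cases "T = 0")
      case True
      have "1 \<le> card Phi" using phi finite_Phi by (metis One_nat_def Suc_leI card_gt_0_iff empty_iff)
      then have "0 \<le> ln (real (card Phi)) / \<eta>" using eta_pos by (intro divide_nonneg_pos ln_ge_zero) auto
      then show ?thesis using True by (simp flip: zero_ereal_def)
    next
      case False
      moreover have "\<Union>Phi \<noteq> {}" using phi env by auto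
      ultimately have "S = \<infinity>" using \<open>\<Union>Phi = {} \<or> T = 0 \<or> S = \<infinity>\<close> by blast
      then show ?thesis using False by simp
    qed
    then show ?thesis using a0 by (intro exI[of _ "\<lambda>_. return_pmf a0"]) auto
  next
    case False
    then obtain x phi where x: "phi \<in> Phi" "x \<in> phi" by blast
    have alg: "\<exists>alg :: ('p \<times> 'o) list \<Rightarrow> 'p pmf. (\<forall>h. set_pmf (alg h) \<subseteq> Pol) \<and>
       (\<forall>phi\<in>Phi. \<forall>env. (\<forall>h. env h \<in> phi) \<longrightarrow>
         exp_regret V Mdl alg env T [] \<le> ln (real (card Phi)) / \<eta> + real T * W)"
      if W: "S \<le> ereal W" for W
    proof -
      have "(INF p\<in>{p. set_pmf p \<subseteq> Pol}. AIR Phi V Mdl \<rho> \<eta> p \<nu>) \<le> ereal W"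
        if "set_pmf \<rho> \<subseteq> Phi" "set_pmf \<nu> \<subseteq> \<Union>(set_pmf \<rho>)" for \<rho> \<nu>
      proof (rule order_trans[OF _ W])
        have "set_pmf \<nu> \<subseteq> \<Union>Phi" using that by blast
        then show "(INF p\<in>{p. set_pmf p \<subseteq> Pol}. AIR Phi V Mdl \<rho> \<eta> p \<nu>) \<le> S"
          unfolding S_def using that(1) by (intro SUP_upper2[of \<rho>] SUP_upper2[of \<nu>]) auto
      qed
      then obtain alg where "\<And>h. set_pmf (alg h) \<subseteq> Pol"
        "\<And>phi env. phi \<in> Phi \<Longrightarrow> (\<And>h. env h \<in> phi) \<Longrightarrow>
          exp_regret V Mdl alg env T [] \<le> ln (real (card Phi)) / \<eta> + real T * W"
        using exists_algorithm[of W T thesis] x by blast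
      then show ?thesis by blast
    qed
    show ?thesis
    proof (cases S)
      case (real W)
      then show ?thesis using alg[of W] by simp
    next
      case PInf
      with False show ?thesis by simp
    next
      case MInf
      \<comment> \<open>With S minus infinity, every real W is an admissible bound. This one makes
        the regret bound equal to -2 T, below the least possible regret -T, so the case cannot
        occur.\<close>
      define W where "W = - (ln (real (card Phi)) / \<eta>) / real T - 2"
      obtain A :: "('p \<times> 'o) list \<Rightarrow> 'p pmf" where A: "\<forall>h. set_pmf (A h) \<subseteq> Pol"
        "exp_regret V Mdl A (\<lambda>_. x) T [] \<le> ln (real (card Phi)) / \<eta> + real T * W"
        using alg[of W] MInf x by auto
      have "\<bar>exp_regret V Mdl A (\<lambda>_. x) T []\<bar> \<le> real T"
        using value_gap_bounded[OF x] A(1) by (intro exp_regret_bounded) blast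
      moreover have "ln (real (card Phi)) / \<eta> + real T * W = - 2 * real T"
        using False by (simp add: W_def field_simps)
      ultimately have False using A(2) False by simp
      then show ?thesis ..
    qed
  qed
  then show ?thesis unfolding S_def .
qed

end
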